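(* $\mathrm{mdim}_{\mathbb{C}}(G_3)=20$ and $\mathrm{mdim}_{\mathbb{R}}(G_3)=28$. Moreover, there is a faithful complex representation $V$ of $G_3$ of dimension $20$ with a decomposition $V=V_r\oplus V_n$ into subrepresentations, $V_r$ being realizable over $\mathbb{R}$ (of dimension 12), such that $V_r\oplus V_n\oplus\overline{V_n}$ is realizable over $\mathbb{R}$ and yields a faithful real representation of $G_3$ of dimension $28$.
   Context: The $3\times3\times3$ Rubik's cube consists of 8 corner cubelets (3 stickers each), 12 edge cubelets (2 stickers each) and 6 face-center cubelets. $G_3$ is the group of permutations of the 48 corner and edge stickers generated by the six moves $u_3,d_3,f_3,b_3,l_3,r_3$, which rotate respectively the top, bottom, front, back, left, right layer of nine cubelets by $90^\circ$ clockwise as seen by an observer outside the cube facing that face. For a finite group $G$ and field $F$, $\mathrm{mdim}_F(G)$ is the smallest dimension of a faithful representation of $G$ over $F$. A complex representation is realizable over $\mathbb{R}$ if it is obtained by extension of scalars from a real representation; $\overline{W}$ denotes the complex conjugate representation of $W$. *)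

theory Defs
  imports Complex_Main "Jordan_Normal_Form.Matrix"
begin

text \<open>Stickers are numbered 1..48 (corner and edge stickers), following the standard
GAP labelling:
top face 1..8, left 9..16, front 17..24, right 25..32, back 33..40, bottom 41..48.
A permutation of the stickers is a function nat => nat that is the identity outside 1..48.
A move sends the sticker at position i to position (move i).\<close>

fun cycle_pairs :: "nat list \<Rightarrow> (nat \<times> nat) list" where
  "cycle_pairs [] = []"
| "cycle_pairs (x # xs) = zip (x # xs) (xs @ [x])"

definition cycle_fun :: "nat list \<Rightarrow> nat \<Rightarrow> nat" where
  "cycle_fun c = foldr (\<lambda>(a, b) f. f(a := b)) (cycle_pairs c) id"

definition perm_of_cycles :: "nat list list \<Rightarrow> nat \<Rightarrow> nat" where
  "perm_of_cycles cs = foldr (\<lambda>c f. cycle_fun c \<circ> f) cs id"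

definition u3 :: "nat \<Rightarrow> nat" where
  "u3 = perm_of_cycles [[1,3,8,6],[2,5,7,4],[9,33,25,17],[10,34,26,18],[11,35,27,19]]"
definition l3 :: "nat \<Rightarrow> nat" where
  "l3 = perm_of_cycles [[9,11,16,14],[10,13,15,12],[1,17,41,40],[4,20,44,37],[6,22,46,35]]"
definition f3 :: "nat \<Rightarrow> nat" where
  "f3 = perm_of_cycles [[17,19,24,22],[18,21,23,20],[6,25,43,16],[7,28,42,13],[8,30,41,11]]"
definition r3 :: "nat \<Rightarrow> nat" where
  "r3 = perm_of_cycles [[25,27,32,30],[26,29,31,28],[3,38,43,19],[5,36,45,21],[8,33,48,24]]"
definition b3 :: "nat \<Rightarrow> nat" where
  "b3 = perm_of_cycles [[33,35,40,38],[34,37,39,36],[3,9,46,32],[2,12,47,29],[1,14,48,27]]"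
definition d3 :: "nat \<Rightarrow> nat" where
  "d3 = perm_of_cycles [[41,43,48,46],[42,45,47,44],[14,22,30,38],[15,23,31,39],[16,24,32,40]]"

definition cube_moves :: "(nat \<Rightarrow> nat) set" where
  "cube_moves = {u3, d3, f3, b3, l3, r3}"

inductive_set G3 :: "(nat \<Rightarrow> nat) set" where
  G3_id: "id \<in> G3"
| G3_gen: "g \<in> G3 \<Longrightarrow> m \<in> cube_moves \<Longrightarrow> m \<circ> g \<in> G3"
| G3_inv: "g \<in> G3 \<Longrightarrow> m \<in> cube_moves \<Longrightarrow> Hilbert_Choice.inv m \<circ> g \<in> G3"

definition is_rep :: "('g \<Rightarrow> 'g) set \<Rightarrow> nat \<Rightarrow> (('g \<Rightarrow> 'g) \<Rightarrow> 'a::field mat) \<Rightarrow> bool" where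
  "is_rep G n \<rho> \<longleftrightarrow>
     (\<forall>g\<in>G. \<rho> g \<in> carrier_mat n n \<and> invertible_mat (\<rho> g)) \<and>
     (\<forall>g\<in>G. \<forall>h\<in>G. \<rho> (g \<circ> h) = \<rho> g * \<rho> h)"

definition faithful_rep :: "('g \<Rightarrow> 'g) set \<Rightarrow> nat \<Rightarrow> (('g \<Rightarrow> 'g) \<Rightarrow> 'a::field mat) \<Rightarrow> bool" where
  "faithful_rep G n \<rho> \<longleftrightarrow> is_rep G n \<rho> \<and> inj_on \<rho> G"

definition mdim :: "'a::field itself \<Rightarrow> ('g \<Rightarrow> 'g) set \<Rightarrow> nat" where
  "mdim T G = (LEAST n. \<exists>\<rho> :: ('g \<Rightarrow> 'g) \<Rightarrow> 'a mat. faithful_rep G n \<rho>)"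

definition realizes :: "('g \<Rightarrow> 'g) set \<Rightarrow> nat \<Rightarrow> (('g \<Rightarrow> 'g) \<Rightarrow> real mat)
     \<Rightarrow> (('g \<Rightarrow> 'g) \<Rightarrow> complex mat) \<Rightarrow> bool" where
  "realizes G n \<sigma> \<rho> \<longleftrightarrow>
     (\<exists>P. P \<in> carrier_mat n n \<and> invertible_mat P \<and>
          (\<forall>g\<in>G. P * \<rho> g = map_mat complex_of_real (\<sigma> g) * P))"

definition realizable_over_R :: "('g \<Rightarrow> 'g) set \<Rightarrow> nat \<Rightarrow> (('g \<Rightarrow> 'g) \<Rightarrow> complex mat) \<Rightarrow> bool" where
  "realizable_over_R G n \<rho> \<longleftrightarrow> (\<exists>\<sigma>. is_rep G n \<sigma> \<and> realizes G n \<sigma> \<rho>)"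

definition dsum_mat :: "'a::zero mat \<Rightarrow> 'a mat \<Rightarrow> 'a mat" where
  "dsum_mat A B = four_block_mat A (0\<^sub>m (dim_row A) (dim_col B)) (0\<^sub>m (dim_row B) (dim_col A)) B"

definition conj_rep :: "(('g \<Rightarrow> 'g) \<Rightarrow> complex mat) \<Rightarrow> ('g \<Rightarrow> 'g) \<Rightarrow> complex mat" where
  "conj_rep \<rho> = (\<lambda>g. map_mat cnj (\<rho> g))"

end

theory Submission
  imports Defs "HOL-Combinatorics.Permutations" "Jordan_Normal_Form.Determinant"
begin

text \<open>
  The elements of \<open>G3\<close> that rotate cubies in place form an abelian normal subgroup of shape
  \<open>3\<^sup>7 \<times> 2\<^sup>1\<^sup>1\<close>, so a faithful representation contains joint eigenvectors (weights) on which its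
  corner part and its edge part act nontrivially. Conjugation by \<open>G3\<close> realizes all pairs of even
  permutations of the corners and of the edges, hence a weight that is nontrivial on corners has at least 8
  conjugates and one that is nontrivial on edges at least 12; a weight nontrivial on both has at least
  96. Eigenvectors of different weights are linearly independent, which gives \<open>8 + 12\<close>. Over the reals
  the weights are closed under complex conjugation, and the cube roots of unity on the corners are not
  real, so the 8 doubles to 16. Conversely the corner twists define an 8-dimensional monomial
  representation with entries in the cube roots of unity, the edge flips a 12-dimensional one with
  entries \<open>\<plusminus>1\<close>, and together they determine every sticker.
\<close>

subsection \<open>Stickers and cubies\<close>

text \<open>One permutation, \<open>spin\<close>, encodes all rotations in place: \<open>G3\<close>
  commutes with it and its orbits on the stickers are the cubies, so an element of \<open>G3\<close>
  is determined by the images of 20 chosen stickers.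

  The total corner twist mod 3 and the total edge flip mod 2 are invariant under \<open>G3\<close>,
  so no single cubie can be rotated alone. The abelian subgroup is therefore handled through pairs,
  one cubie forward and another back, and a weight becomes a function \<open>x\<close> on cubies of
  which only the ratios \<open>x i / x j\<close> are visible. This shapes the counting:
  rearrangements of \<open>x\<close> that differ by a scalar are the same weight, so conjugates must
  be told apart projectively, and in the real case also from complex conjugates.

  The bounds 8 and 12 are sharp because of weights with one exceptional cubie; these are exactly the
  weights of the two monomial representations. Weights nontrivial on both kinds of cubies need no
  finer treatment, since 96 already exceeds 28.\<close>

text \<open>Corner cubies are numbered 0..7 and edge cubies 8..19. Each corner lists its stickers in the same
  rotational sense, so that every move commutes with \<open>spin\<close>.\<close>
definition cubies :: "nat list list" where
  "cubies = [[1,9,35],[3,33,27],[6,17,11],[8,25,19],[14,46,40],[16,22,41],[24,30,43],[32,38,48],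
     [2,34],[4,10],[5,26],[7,18],[12,37],[13,20],[15,44],[21,28],[23,42],[29,36],[31,45],[39,47]]"

definition spin :: "nat \<Rightarrow> nat" where "spin = perm_of_cycles cubies"

text \<open>The junk value 20 is returned for numbers that are not stickers.\<close>
definition cubie :: "nat \<Rightarrow> nat" where "cubie z = length (takeWhile (\<lambda>c. z \<notin> set c) cubies)"

text \<open>The cubies are disjoint, so the filter leaves the one list that contains
  \<open>z\<close>; for a number that is no sticker it leaves nothing and the value is 0.\<close>

definition twist :: "nat \<Rightarrow> nat" where
  "twist z = length (takeWhile (\<lambda>y. y \<noteq> z) (concat (filter (\<lambda>c. z \<in> set c) cubies)))"

definition stickers :: "nat list" where
  "stickers = [1, 2, 3, 4, 5, 6, 7, 8, 9, 10, 11, 12, 13, 14, 15, 16, 17, 18, 19, 20, 21, 22, 23, 24,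
     25, 26, 27, 28, 29, 30, 31, 32, 33, 34, 35, 36, 37, 38, 39, 40, 41, 42, 43, 44, 45, 46, 47, 48]"

definition home :: "nat \<Rightarrow> nat" where "home c = hd (cubies ! c)"

text \<open>Products of cycles are evaluated once, into tables; all later finite checks look values
  up instead of unfolding cycles.\<close>

lemma u3_values: "map u3 stickers =
    [3, 5, 8, 2, 7, 1, 4, 6, 33, 34, 35, 12, 13, 14, 15, 16, 9, 10, 11, 20, 21, 22, 23, 24,
     17, 18, 19, 28, 29, 30, 31, 32, 25, 26, 27, 36, 37, 38, 39, 40, 41, 42, 43, 44, 45, 46, 47, 48]"
  by (simp add: stickers_def u3_def perm_of_cycles_def cycle_fun_def)

lemma d3_values: "map d3 stickers =
    [1, 2, 3, 4, 5, 6, 7, 8, 9, 10, 11, 12, 13, 22, 23, 24, 17, 18, 19, 20, 21, 30, 31, 32,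
     25, 26, 27, 28, 29, 38, 39, 40, 33, 34, 35, 36, 37, 14, 15, 16, 43, 45, 48, 42, 47, 41, 44, 46]"
  by (simp add: stickers_def d3_def perm_of_cycles_def cycle_fun_def)

lemma f3_values: "map f3 stickers =
    [1, 2, 3, 4, 5, 25, 28, 30, 9, 10, 8, 12, 7, 14, 15, 6, 19, 21, 24, 18, 23, 17, 20, 22,
     43, 26, 27, 42, 29, 41, 31, 32, 33, 34, 35, 36, 37, 38, 39, 40, 11, 13, 16, 44, 45, 46, 47, 48]"
  by (simp add: stickers_def f3_def perm_of_cycles_def cycle_fun_def)

lemma b3_values: "map b3 stickers =
    [14, 12, 9, 4, 5, 6, 7, 8, 46, 10, 11, 47, 13, 48, 15, 16, 17, 18, 19, 20, 21, 22, 23, 24,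
     25, 26, 1, 28, 2, 30, 31, 3, 35, 37, 40, 34, 39, 33, 36, 38, 41, 42, 43, 44, 45, 32, 29, 27]"
  by (simp add: stickers_def b3_def perm_of_cycles_def cycle_fun_def)

lemma l3_values: "map l3 stickers =
    [17, 2, 3, 20, 5, 22, 7, 8, 11, 13, 16, 10, 15, 9, 12, 14, 41, 18, 19, 44, 21, 46, 23, 24,
     25, 26, 27, 28, 29, 30, 31, 32, 33, 34, 6, 36, 4, 38, 39, 1, 40, 42, 43, 37, 45, 35, 47, 48]"
  by (simp add: stickers_def l3_def perm_of_cycles_def cycle_fun_def)

lemma r3_values: "map r3 stickers =
    [1, 2, 38, 4, 36, 6, 7, 33, 9, 10, 11, 12, 13, 14, 15, 16, 17, 18, 3, 20, 5, 22, 23, 8,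
     27, 29, 32, 26, 31, 25, 28, 30, 48, 34, 35, 45, 37, 43, 39, 40, 41, 42, 19, 44, 21, 46, 47, 24]"
  by (simp add: stickers_def r3_def perm_of_cycles_def cycle_fun_def)

lemma spin_values: "map spin stickers =
    [9, 34, 33, 10, 26, 17, 18, 25, 35, 4, 6, 37, 20, 46, 44, 22, 11, 7, 8, 13, 28, 41, 42, 30,
     19, 5, 3, 21, 36, 43, 45, 38, 27, 2, 1, 29, 12, 48, 47, 14, 16, 23, 24, 15, 31, 40, 39, 32]"
  by (simp add: stickers_def spin_def cubies_def perm_of_cycles_def cycle_fun_def)

lemma cubie_values: "map cubie stickers =
    [0, 8, 1, 9, 10, 2, 11, 3, 0, 9, 2, 12, 13, 4, 14, 5, 2, 11, 3, 13, 15, 5, 16, 6,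
     3, 10, 1, 15, 17, 6, 18, 7, 1, 8, 0, 17, 12, 7, 19, 4, 5, 16, 6, 14, 18, 4, 19, 7]"
  by (simp add: stickers_def cubie_def cubies_def)

lemma twist_values: "map twist stickers =
    [0, 0, 0, 0, 0, 0, 0, 0, 1, 1, 2, 0, 0, 0, 0, 0, 1, 1, 2, 1, 0, 1, 0, 0,
     1, 1, 2, 1, 0, 1, 0, 0, 1, 1, 2, 1, 1, 1, 0, 2, 2, 1, 2, 1, 1, 1, 1, 2]"
  by (simp add: stickers_def twist_def cubies_def)

lemmas move_values = u3_values d3_values f3_values b3_values l3_values r3_values
lemmas sticker_values = spin_values cubie_values twist_values

lemma funpow_eval: "(f ^^ 0) x = x" "(f ^^ 1) x = f x" "(f ^^ 2) x = f (f x)" "(f ^^ 3) x = f (f (f x))"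
  by (simp_all add: eval_nat_numeral)
text \<open>Splitting each table into one equation per sticker gives rewrite rules; with
  \<open>all_stickers\<close> they decide statements about all 48 stickers.\<close>

lemmas move_eval = move_values[unfolded stickers_def list.map list.inject simp_thms]
lemmas sticker_eval = sticker_values[unfolded stickers_def list.map list.inject simp_thms]

lemma all_stickers:
  fixes P :: "nat \<Rightarrow> bool"
  shows "(\<forall>z\<in>{1..48}. P z) \<longleftrightarrow> P 1 \<and> P 2 \<and> P 3 \<and> P 4 \<and> P 5 \<and> P 6 \<and> P 7 \<and> P 8 \<and> P 9 \<and> P 10 \<and> P 11 \<and> P 12 \<and> P 13 \<and> P 14 \<and> P 15 \<and> P 16 \<and> P 17 \<and> P 18 \<and> P 19 \<and> P 20 \<and> P 21 \<and> P 22 \<and> P 23 \<and> P 24 \<and> P 25 \<and> P 26 \<and> P 27 \<and> P 28 \<and> P 29 \<and> P 30 \<and> P 31 \<and> P 32 \<and> P 33 \<and> P 34 \<and> P 35 \<and> P 36 \<and> P 37 \<and> P 38 \<and> P 39 \<and> P 40 \<and> P 41 \<and> P 42 \<and> P 43 \<and> P 44 \<and> P 45 \<and> P 46 \<and> P 47 \<and> P 48"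
proof -
  have "[1..<49] = stickers" by (simp add: stickers_def upt_conv_Cons)
  then have "{1..48} = set stickers" using set_upt[of 1 49] by (simp add: atLeastLessThanSuc_atLeastAtMost[symmetric] del: set_upt)
  then show ?thesis unfolding stickers_def by simp
qed

lemma cubie_outside: "z \<notin> {1..48} \<Longrightarrow> cubie z = 20"
proof -
  assume z: "z \<notin> {1..48}"
  have "list_all (\<lambda>c. list_all (\<lambda>y. y \<in> {1..48}) c) cubies" by (simp add: cubies_def)
  then have "\<And>c. c \<in> set cubies \<Longrightarrow> z \<notin> set c" using z by (auto simp: list_all_iff)
  then have "takeWhile (\<lambda>c. z \<notin> set c) cubies = cubies" by (simp add: takeWhile_eq_all_conv)
  then show ?thesis unfolding cubie_def by (simp add: cubies_def)
qed

lemma cubie_less: "cubie z < 20 \<longleftrightarrow> z \<in> {1..48}"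
proof -
  have "\<forall>z\<in>{1..48}. cubie z < 20" by (simp only: all_stickers sticker_eval) simp
  then show ?thesis using cubie_outside[of z] by (cases "z \<in> {1..48}") (blast, simp del: atLeastAtMost_iff)
qed

lemma foldr_upd_other:
  "z \<notin> fst ` set ps \<Longrightarrow> foldr (\<lambda>(a, b) f. f(a := b)) ps id z = z"
  by (induction ps) auto

lemma cycle_fun_other: "z \<notin> set c \<Longrightarrow> cycle_fun c z = z"
  unfolding cycle_fun_def
  by (rule foldr_upd_other, cases c) (auto dest: set_zip_leftD)

lemma perm_of_cycles_other: "z \<notin> set (concat cs) \<Longrightarrow> perm_of_cycles cs z = z"
  unfolding perm_of_cycles_def by (induction cs) (auto simp: cycle_fun_other)

lemma spin_outside: "z \<notin> {1..48} \<Longrightarrow> spin z = z"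
  unfolding spin_def by (rule perm_of_cycles_other) (auto simp: cubies_def)

lemma move_outside: "m \<in> cube_moves \<Longrightarrow> z \<notin> {1..48} \<Longrightarrow> m z = z"
  unfolding cube_moves_def u3_def d3_def f3_def b3_def l3_def r3_def
  by (elim insertE emptyE; hypsubst; intro perm_of_cycles_other) auto

lemma move_spin_inside: "m \<in> cube_moves \<Longrightarrow> \<forall>z\<in>{1..48}. m (spin z) = spin (m z)"
  unfolding cube_moves_def
  by (elim insertE emptyE; hypsubst; simp only: all_stickers move_eval sticker_eval; simp)

lemma move_inside: "m \<in> cube_moves \<Longrightarrow> \<forall>z\<in>{1..48}. m z \<in> {1..48}"
  unfolding cube_moves_def
  by (elim insertE emptyE; hypsubst; simp only: all_stickers move_eval; simp)

lemma move_corner_inside: "m \<in> cube_moves \<Longrightarrow> \<forall>z\<in>{1..48}. cubie (m z) < 8 \<longleftrightarrow> cubie z < 8"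
  unfolding cube_moves_def
  by (elim insertE emptyE; hypsubst; simp only: all_stickers move_eval sticker_eval; simp)

lemma move_order_inside: "m \<in> cube_moves \<Longrightarrow> \<forall>z\<in>{1..48}. m (m (m (m z))) = z"
  unfolding cube_moves_def
  by (elim insertE emptyE; hypsubst; simp only: all_stickers move_eval; simp)

section \<open>Inverses in \<open>G3\<close> and what its elements preserve\<close>

lemma move_order: "m \<in> cube_moves \<Longrightarrow> m (m (m (m z))) = z"
  using move_order_inside[of m] move_outside[of m z]
  by (cases "z \<in> {1..48}") (blast, simp del: atLeastAtMost_iff)

lemma inv_move: "m \<in> cube_moves \<Longrightarrow> Hilbert_Choice.inv m = m \<circ> m \<circ> m"
  by (rule inv_unique_comp) (auto simp: fun_eq_iff move_order)

text \<open>The inverse of a move is its third power, so an inverse step is three forward steps and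
  needs no case of its own.\<close>

lemma G3_move_induct [consumes 1, case_names id move]:
  assumes "g \<in> G3" and "P id" and move: "\<And>g m. g \<in> G3 \<Longrightarrow> m \<in> cube_moves \<Longrightarrow> P g \<Longrightarrow> P (m \<circ> g)"
  shows "P g"
  using assms(1)
proof induction
  case (G3_inv g m)
  have "Hilbert_Choice.inv m \<circ> g = m \<circ> (m \<circ> (m \<circ> g))"
    using inv_move[OF G3_inv.hyps(2)] by (simp add: o_assoc)
  then show ?case
    using move G3_inv.hyps G3_inv.IH by (metis G3_gen)
next
  case (G3_gen g m)
  show ?case by (rule move) fact+
qed (fact assms(2))

lemma G3_comp: "g \<in> G3 \<Longrightarrow> h \<in> G3 \<Longrightarrow> g \<circ> h \<in> G3"
  by (induction rule: G3_move_induct) (auto simp: o_assoc[symmetric] intro: G3_gen)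

lemma cube_moves_G3: "m \<in> cube_moves \<Longrightarrow> m \<in> G3"
  using G3_gen[OF G3_id] by auto

lemma G3_inverse:
  assumes "g \<in> G3" shows "\<exists>h\<in>G3. h \<circ> g = id \<and> g \<circ> h = id"
  using assms
proof (induction rule: G3_move_induct)
  case id then show ?case using G3_id by (intro bexI[of _ id]) auto
next
  case (move g m)
  then obtain h where h: "h \<in> G3" "h \<circ> g = id" "g \<circ> h = id" by blast
  have m: "m \<circ> m \<circ> m \<in> G3" using move cube_moves_G3 G3_comp by metis
  have "h \<circ> (m \<circ> m \<circ> m) \<in> G3" using m h G3_comp by blast
  moreover have "h \<circ> (m \<circ> m \<circ> m) \<circ> (m \<circ> g) = id" "(m \<circ> g) \<circ> (h \<circ> (m \<circ> m \<circ> m)) = id"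
    using h move_order[OF move(2)] by (simp_all add: fun_eq_iff)
  ultimately show ?case by blast
qed

lemma G3_funpow: "g \<in> G3 \<Longrightarrow> g ^^ k \<in> G3"
  by (induction k) (auto simp: G3_id G3_comp simp flip: id_def)

lemma cubie_spin [simp]: "cubie (spin z) = cubie z"
proof (cases "z \<in> {1..48}")
  case True
  have "\<forall>z\<in>{1..48}. cubie (spin z) = cubie z" by (simp only: all_stickers sticker_eval)
  then show ?thesis using True by blast
qed (simp add: spin_outside)

lemma cubie_funpow_spin [simp]: "cubie ((spin ^^ k) z) = cubie z"
  by (induction k) auto

lemma spin_order_corner:
  assumes "cubie z < 8" shows "(spin ^^ 3) z = z"
proof -
  have "\<forall>z\<in>{1..48}. cubie z < 8 \<longrightarrow> (spin ^^ 3) z = z"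
    by (simp only: all_stickers sticker_eval funpow_eval) simp
  then show ?thesis using assms cubie_outside[of z] by force
qed

lemma spin_order_edge:
  assumes "8 \<le> cubie z" shows "(spin ^^ 2) z = z"
proof (cases "z \<in> {1..48}")
  case True
  have "\<forall>z\<in>{1..48}. 8 \<le> cubie z \<longrightarrow> (spin ^^ 2) z = z"
    by (simp only: all_stickers sticker_eval funpow_eval) simp
  then show ?thesis using True assms by blast
qed (simp add: funpow_eval spin_outside)

lemma G3_outside: "g \<in> G3 \<Longrightarrow> z \<notin> {1..48} \<Longrightarrow> g z = z"
  by (induction rule: G3_move_induct) (auto simp: move_outside)

lemma G3_inside: "g \<in> G3 \<Longrightarrow> z \<in> {1..48} \<Longrightarrow> g z \<in> {1..48}"
  by (induction rule: G3_move_induct) (use move_inside in auto)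

text \<open>Lying in the centralizer of \<open>spin\<close> is what lets \<open>G3\<close> act on
  cubies and what makes twists add up under composition.\<close>

lemma G3_spin: "g \<in> G3 \<Longrightarrow> g (spin z) = spin (g z)"
proof (induction rule: G3_move_induct)
  case (move g m)
  then show ?case
    using move_spin_inside[of m] move_outside[of m] spin_outside by (cases "g z \<in> {1..48}") auto
qed simp

lemma G3_funpow_spin: "g \<in> G3 \<Longrightarrow> g ((spin ^^ k) z) = (spin ^^ k) (g z)"
  by (induction k) (auto simp: G3_spin)

lemma G3_corner: "g \<in> G3 \<Longrightarrow> cubie (g z) < 8 \<longleftrightarrow> cubie z < 8"
proof (induction rule: G3_move_induct)
  case (move g m)
  then show ?case
    using move_corner_inside[of m] move_outside[of m] by (cases "g z \<in> {1..48}") auto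
qed simp

lemma G3_cubie_less: "g \<in> G3 \<Longrightarrow> cubie (g z) < 20 \<longleftrightarrow> cubie z < 20"
  unfolding cubie_less using G3_inside[of g z] G3_outside[of g z] by metis

section \<open>Coordinates of stickers, and opposite rotations of two cubies\<close>

lemma home_values: "map home [0, 1, 2, 3, 4, 5, 6, 7, 8, 9, 10, 11, 12, 13, 14, 15, 16, 17, 18, 19] =
    [1, 3, 6, 8, 14, 16, 24, 32, 2, 4, 5, 7, 12, 13, 15, 21, 23, 29, 31, 39]"
  by (simp add: home_def cubies_def)
lemmas home_eval = home_values[unfolded list.map list.inject simp_thms]

lemma home_props:
  assumes "c < 20"
  shows "home c \<in> {1..48}" "cubie (home c) = c" "twist (home c) = 0"
proof -
  have "[0..<20] = [0, 1, 2, 3, 4, 5, 6, 7, 8, 9, 10, 11, 12, 13, 14, 15, 16, 17, 18, 19]"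
    by (simp add: upt_conv_Cons)
  moreover have "list_all (\<lambda>c. home c \<in> {1..48} \<and> cubie (home c) = c \<and> twist (home c) = 0)
      [0, 1, 2, 3, 4, 5, 6, 7, 8, 9, 10, 11, 12, 13, 14, 15, 16, 17, 18, 19]"
    by (simp only: list.pred_inject home_eval sticker_eval) simp
  ultimately have "list_all (\<lambda>c. home c \<in> {1..48} \<and> cubie (home c) = c \<and> twist (home c) = 0) [0..<20]"
    by simp
  then show "home c \<in> {1..48}" "cubie (home c) = c" "twist (home c) = 0"
    using assms by (auto simp: list_all_iff)
qed

text \<open>The pair of \<open>cubie\<close> and \<open>twist\<close> serves as coordinates; with
  \<open>G3_funpow_spin\<close> it reduces an element of \<open>G3\<close> to its values on home
  stickers.\<close>

lemma sticker_home: "cubie z < 20 \<Longrightarrow> z = (spin ^^ twist z) (home (cubie z))"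
proof -
  have "\<forall>z\<in>{1..48}. z = (spin ^^ twist z) (home (cubie z))"
    by (simp only: all_stickers sticker_eval home_eval funpow_eval)
  then show "cubie z < 20 \<Longrightarrow> z = (spin ^^ twist z) (home (cubie z))" by (auto simp: cubie_less)
qed

text \<open>A rotation of a cubie is a power of \<open>spin\<close>; since \<open>spin\<close> has order 3 on corners and 2 on edges,
  the exponent 5 stands for \<open>-1\<close>.\<close>
definition twist_pair :: "nat \<Rightarrow> nat \<Rightarrow> nat \<Rightarrow> nat" where
  "twist_pair i j z = (spin ^^ ((if cubie z = i then 1 else 0) + (if cubie z = j then 5 else 0))) z"

text \<open>6 is the common multiple of the orders 3 on corners and 2 on edges, so exponents may be
  reduced mod 6 for both kinds at once.\<close>

lemma spin_order: "(spin ^^ (6 * k)) z = z"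
proof -
  have "(spin ^^ 6) z = z" for z
  proof (cases "cubie z < 8")
    case True
    then show ?thesis using spin_order_corner[of z] funpow_add[of 3 3 spin] by simp
  next
    case False
    then show ?thesis using spin_order_edge[of z] funpow_add[of 2 4 spin] funpow_add[of 2 2 spin] by simp
  qed
  then have "spin ^^ 6 = id" by auto
  then show ?thesis by (simp add: funpow_mult[symmetric])
qed

lemma spin_power_mod: "(spin ^^ (a + 6 * k)) z = (spin ^^ a) z"
  by (simp add: funpow_add spin_order)

lemma cubie_twist_pair [simp]: "cubie (twist_pair i j z) = cubie z"
  by (simp add: twist_pair_def)

lemma twist_pair_same: "twist_pair i i = id"
  using spin_order[of 1] by (auto simp: twist_pair_def)

text \<open>The middle cubie \<open>j\<close> collects the exponents 5 and 1, a full period. In a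
  representation this becomes the cocycle rule that lets eigenvalues be written as ratios.\<close>

lemma twist_pair_comp: "twist_pair i j \<circ> twist_pair j k = twist_pair i k"
proof
  fix z
  define e where "e l = (if cubie z = l then 1 else 0 :: nat)" for l
  have t: "twist_pair l l' y = (spin ^^ (e l + 5 * e l')) y" if "cubie y = cubie z" for l l' y
    using that by (simp add: twist_pair_def e_def if_distrib cong: if_cong)
  have "(twist_pair i j \<circ> twist_pair j k) z = (spin ^^ (e i + 5 * e j)) ((spin ^^ (e j + 5 * e k)) z)"
    by (simp add: t)
  also have "\<dots> = (spin ^^ ((e i + 5 * e k) + 6 * e j)) z"
    by (simp add: funpow_add[symmetric, unfolded comp_def fun_eq_iff, rule_format] algebra_simps)
  also have "\<dots> = twist_pair i k z" by (simp add: spin_power_mod t)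
  finally show "(twist_pair i j \<circ> twist_pair j k) z = twist_pair i k z" .
qed

lemma twist_pair_commute: "twist_pair i j \<circ> twist_pair k l = twist_pair k l \<circ> twist_pair i j"
proof
  fix z
  have *: "(spin ^^ a) ((spin ^^ b) z) = (spin ^^ b) ((spin ^^ a) z)" for a b
    by (metis add.commute comp_apply funpow_add)
  show "(twist_pair i j \<circ> twist_pair k l) z = (twist_pair k l \<circ> twist_pair i j) z"
    by (simp only: comp_apply twist_pair_def[of i j] twist_pair_def[of k l] cubie_funpow_spin *)
qed

lemma twist_pair_corner_order:
  assumes "i < 8" "j < 8" shows "twist_pair i j \<circ> twist_pair i j \<circ> twist_pair i j = id"
proof
  fix z
  define a where "a = (if cubie z = i then 1 else 0 :: nat) + (if cubie z = j then 5 else 0)"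
  have triple: "3 * a = a + a + a" by simp
  have "(twist_pair i j \<circ> twist_pair i j \<circ> twist_pair i j) z = (spin ^^ a) ((spin ^^ a) ((spin ^^ a) z))"
    by (simp only: comp_apply twist_pair_def cubie_funpow_spin a_def)
  also have "\<dots> = ((spin ^^ 3) ^^ a) z"
    by (simp only: funpow_mult funpow_add comp_apply triple)
  also have "\<dots> = z"
  proof (cases "cubie z < 8")
    case True
    have "((spin ^^ 3) ^^ n) z = z" for n using True by (induction n) (auto simp: spin_order_corner)
    then show ?thesis .
  next
    case False then have "a = 0" using assms by (auto simp: a_def)
    then show ?thesis by simp
  qed
  finally show "(twist_pair i j \<circ> twist_pair i j \<circ> twist_pair i j) z = id z" by simp
qed

lemma twist_pair_edge_order:
  assumes "8 \<le> i" "8 \<le> j" shows "twist_pair i j \<circ> twist_pair i j = id"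
proof
  fix z
  define a where "a = (if cubie z = i then 1 else 0 :: nat) + (if cubie z = j then 5 else 0)"
  have "(twist_pair i j \<circ> twist_pair i j) z = (spin ^^ a) ((spin ^^ a) z)"
    by (simp only: comp_apply twist_pair_def cubie_funpow_spin a_def)
  also have "\<dots> = ((spin ^^ 2) ^^ a) z"
    by (simp only: funpow_mult funpow_add comp_apply mult_2)
  also have "\<dots> = z"
  proof (cases "cubie z < 8")
    case False
    then have "((spin ^^ 2) ^^ n) z = z" for n by (induction n) (auto simp: spin_order_edge)
    then show ?thesis .
  next
    case True then have "a = 0" using assms by (auto simp: a_def)
    then show ?thesis by simp
  qed
  finally show "(twist_pair i j \<circ> twist_pair i j) z = id z" by simp
qed

lemma twist_pair_outside: "z \<notin> {1..48} \<Longrightarrow> twist_pair i j z = z"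
proof -
  assume "z \<notin> {1..48}"
  then have "(spin ^^ k) z = z" for k by (induction k) (auto simp: spin_outside)
  then show ?thesis by (simp add: twist_pair_def)
qed

text \<open>Orientations are forgotten: any \<open>g\<close> inducing \<open>\<pi>\<close> will do.
  Requiring \<open>permutes {..<20}\<close> makes \<open>\<pi>\<close> a genuine permutation that
  fixes the junk label 20.\<close>

definition cubie_perms :: "(nat \<Rightarrow> nat) set" where
  "cubie_perms = {\<pi>. \<pi> permutes {..<20} \<and> (\<exists>g\<in>G3. \<forall>z. cubie (g z) = \<pi> (cubie z))}"

text \<open>Since \<open>g\<close> commutes with \<open>spin\<close>, conjugation changes only which
  cubies are rotated. Hence weights are permuted by \<open>cubie_perms\<close>.\<close>

lemma twist_pair_conj:
  assumes "g \<in> G3" "inj \<pi>" "\<And>z. cubie (g z) = \<pi> (cubie z)"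
  shows "g \<circ> twist_pair i j = twist_pair (\<pi> i) (\<pi> j) \<circ> g"
  using assms by (auto simp: fun_eq_iff twist_pair_def G3_funpow_spin inj_eq)

lemma cubie_perms_comp: "\<pi> \<in> cubie_perms \<Longrightarrow> \<pi>' \<in> cubie_perms \<Longrightarrow> \<pi> \<circ> \<pi>' \<in> cubie_perms"
proof -
  assume "\<pi> \<in> cubie_perms" "\<pi>' \<in> cubie_perms"
  then obtain g g' where "g \<in> G3" "\<forall>z. cubie (g z) = \<pi> (cubie z)" "g' \<in> G3" "\<forall>z. cubie (g' z) = \<pi>' (cubie z)"
    and p: "\<pi> permutes {..<20}" "\<pi>' permutes {..<20}" by (auto simp: cubie_perms_def)
  then have "g \<circ> g' \<in> G3" "\<forall>z. cubie ((g \<circ> g') z) = (\<pi> \<circ> \<pi>') (cubie z)" by (auto simp: G3_comp)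
  then show ?thesis using permutes_compose[OF p(2,1)] unfolding cubie_perms_def by blast
qed

lemma cubie_perms_id: "id \<in> cubie_perms"
  using G3_id by (auto simp: cubie_perms_def permutes_id intro: bexI[of _ id])

lemma cubie_perms_inverse:
  assumes "\<pi> \<in> cubie_perms" shows "Hilbert_Choice.inv \<pi> \<in> cubie_perms"
proof -
  obtain g where g: "g \<in> G3" "\<And>z. cubie (g z) = \<pi> (cubie z)" and p: "\<pi> permutes {..<20}"
    using assms by (auto simp: cubie_perms_def)
  obtain h where h: "h \<in> G3" "g \<circ> h = id" using G3_inverse[OF g(1)] by blast
  have "cubie (h z) = Hilbert_Choice.inv \<pi> (cubie z)" for z
  proof -
    have "\<pi> (cubie (h z)) = cubie z" using g(2)[of "h z"] h(2) by (simp add: pointfree_idE)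
    then show ?thesis using permutes_inverses[OF p] by metis
  qed
  then show ?thesis using h(1) permutes_inv[OF p] by (auto simp: cubie_perms_def)
qed

section \<open>Explicit words for three-cycles and for opposite rotations\<close>

fun word_perm :: "((nat \<Rightarrow> nat) \<times> nat) list \<Rightarrow> nat \<Rightarrow> nat" where
  "word_perm [] z = z"
| "word_perm ((m, k) # w) z = (m ^^ k) (word_perm w z)"

lemma word_perm_G3: "fst ` set w \<subseteq> cube_moves \<Longrightarrow> word_perm w \<in> G3"
proof (induction w)
  case Nil
  have "word_perm [] = id" by auto
  then show ?case using G3_id by metis
next
  case (Cons mk w)
  have "word_perm (mk # w) = (fst mk ^^ snd mk) \<circ> word_perm w" by (cases mk) auto
  moreover have "(fst mk ^^ snd mk) \<circ> word_perm w \<in> G3"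
    using Cons by (intro G3_comp[OF G3_funpow[OF cube_moves_G3]]) auto
  ultimately show ?case by metis
qed

text \<open>For distinct labels the product of transpositions is the three-cycle sending
  \<open>a\<close> to \<open>c\<close>, \<open>c\<close> to \<open>b\<close> and \<open>b\<close> to
  \<open>a\<close>. Only positions are compared, so the word may twist the cubies as well.\<close>

lemma word_cubie_perm:
  assumes w: "fst ` set w \<subseteq> cube_moves" and a: "a < 20 \<and> b < 20 \<and> c < 20"
    and eq: "\<forall>z\<in>{1..48}. cubie (word_perm w z) = (transpose a b \<circ> transpose a c) (cubie z)"
  shows "transpose a b \<circ> transpose a c \<in> cubie_perms"
proof -
  have "cubie (word_perm w z) = (transpose a b \<circ> transpose a c) (cubie z)" for z
  proof (cases "z \<in> {1..48}")
    case False
    then show ?thesis using G3_outside[OF word_perm_G3[OF w] False] cubie_outside[OF False] a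
      by (simp add: transpose_apply_other)
  qed (use eq in blast)
  moreover have "transpose a b \<circ> transpose a c permutes {..<20}"
    using a by (intro permutes_compose permutes_swap_id) auto
  ultimately show ?thesis using word_perm_G3[OF w] by (auto simp: cubie_perms_def)
qed

lemma word_twist_pair:
  assumes w: "fst ` set w \<subseteq> cube_moves"
    and eq: "\<forall>z\<in>{1..48}. word_perm w z =
      (if cubie z = i then spin z else if cubie z = j then spin (spin (spin (spin (spin z)))) else z)"
    and "i \<noteq> j"
  shows "twist_pair i j \<in> G3"
proof -
  have "word_perm w z = twist_pair i j z" for z
  proof (cases "z \<in> {1..48}")
    case False
    then show ?thesis using G3_outside[OF word_perm_G3[OF w] False] twist_pair_outside[OF False] by simp
  next
    case True
    then have "word_perm w z = (if cubie z = i then spin z else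
        if cubie z = j then spin (spin (spin (spin (spin z)))) else z)" using eq by blast
    then show ?thesis using \<open>i \<noteq> j\<close> by (simp add: twist_pair_def eval_nat_numeral)
  qed
  then have "word_perm w = twist_pair i j" by auto
  then show ?thesis using word_perm_G3[OF w] by simp
qed

lemmas word_eval = all_stickers word_perm.simps funpow_eval move_eval sticker_eval

text \<open>The words below were found by a computer search through conjugated commutators.\<close>
lemma corner_cycle_2: "transpose 0 1 \<circ> transpose 0 2 \<in> cubie_perms"
  by (rule word_cubie_perm[where w = "[(u3, 1), (f3, 1), (u3, 3), (b3, 3), (u3, 1), (f3, 3), (u3, 3), (b3, 1)]"],
      simp add: cube_moves_def, simp, simp only: word_eval, simp add: transpose_def)

text \<open>Like the other corner words, this is a commutator of \<open>x y x^-1\<close> with a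
  power of the move of the face opposite to \<open>y\<close>. The supports of the two factors share
  exactly one corner, so the commutator is a three-cycle of corners.\<close>

lemma corner_cycle_3: "transpose 0 1 \<circ> transpose 0 3 \<in> cubie_perms"
  by (rule word_cubie_perm[where w = "[(u3, 1), (l3, 1), (u3, 3), (r3, 3), (u3, 1), (l3, 3), (u3, 3), (r3, 1)]"],
      simp add: cube_moves_def, simp, simp only: word_eval, simp add: transpose_def)

lemma corner_cycle_4: "transpose 0 1 \<circ> transpose 0 4 \<in> cubie_perms"
  by (rule word_cubie_perm[where w = "[(l3, 1), (d3, 1), (l3, 3), (u3, 1), (l3, 1), (d3, 3), (l3, 3), (u3, 3)]"],
      simp add: cube_moves_def, simp, simp only: word_eval, simp add: transpose_def)

lemma corner_cycle_5: "transpose 0 1 \<circ> transpose 0 5 \<in> cubie_perms"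
  by (rule word_cubie_perm[where w = "[(u3, 1), (f3, 3), (u3, 3), (b3, 3), (u3, 1), (f3, 1), (u3, 3), (b3, 1)]"],
      simp add: cube_moves_def, simp, simp only: word_eval, simp add: transpose_def)

lemma corner_cycle_6: "transpose 0 1 \<circ> transpose 0 6 \<in> cubie_perms"
  by (rule word_cubie_perm[where w = "[(u3, 1), (l3, 1), (u3, 3), (r3, 2), (u3, 1), (l3, 3), (u3, 3), (r3, 2)]"],
      simp add: cube_moves_def, simp, simp only: word_eval, simp add: transpose_def)

lemma corner_cycle_7: "transpose 0 1 \<circ> transpose 0 7 \<in> cubie_perms"
  by (rule word_cubie_perm[where w = "[(u3, 1), (l3, 1), (u3, 3), (r3, 1), (u3, 1), (l3, 3), (u3, 3), (r3, 3)]"],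
      simp add: cube_moves_def, simp, simp only: word_eval, simp add: transpose_def)

lemma edge_cycle_10: "transpose 8 9 \<circ> transpose 8 10 \<in> cubie_perms"
  by (rule word_cubie_perm[where w = "[(b3, 2), (u3, 1), (l3, 1), (r3, 3), (b3, 2), (r3, 1), (l3, 3), (u3, 1), (b3, 2)]"],
      simp add: cube_moves_def, simp, simp only: word_eval, simp add: transpose_def)

text \<open>Every edge word is a conjugate of the classical pattern
  \<open>x (y z^-1) w^2 (y z^-1)^-1 x\<close>, with \<open>y\<close> and \<open>z\<close> turning
  opposite faces in the same absolute direction.\<close>

lemma edge_cycle_11: "transpose 8 9 \<circ> transpose 8 11 \<in> cubie_perms"
  by (rule word_cubie_perm[where w = "[(l3, 2), (u3, 1), (f3, 1), (b3, 3), (l3, 2), (b3, 1), (f3, 3), (u3, 1), (l3, 2)]"],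
      simp add: cube_moves_def, simp, simp only: word_eval, simp add: transpose_def)

lemma edge_cycle_12: "transpose 8 9 \<circ> transpose 8 12 \<in> cubie_perms"
  by (rule word_cubie_perm[where w = "[(u3, 2), (f3, 1), (l3, 1), (f3, 3), (b3, 1), (u3, 2), (f3, 1), (b3, 3), (l3, 1),
      (f3, 3), (u3, 2)]"],
      simp add: cube_moves_def, simp, simp only: word_eval, simp add: transpose_def)

lemma edge_cycle_13: "transpose 8 9 \<circ> transpose 8 13 \<in> cubie_perms"
  by (rule word_cubie_perm[where w = "[(u3, 3), (b3, 3), (l3, 1), (f3, 3), (b3, 1), (u3, 2), (f3, 1), (b3, 3), (l3, 1),
      (b3, 1), (u3, 1)]"],
      simp add: cube_moves_def, simp, simp only: word_eval, simp add: transpose_def)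

lemma edge_cycle_14: "transpose 8 9 \<circ> transpose 8 14 \<in> cubie_perms"
  by (rule word_cubie_perm[where w = "[(b3, 1), (l3, 3), (u3, 3), (d3, 1), (b3, 2), (u3, 1), (d3, 3), (l3, 3), (b3, 3)]"],
      simp add: cube_moves_def, simp, simp only: word_eval, simp add: transpose_def)

lemma edge_cycle_15: "transpose 8 9 \<circ> transpose 8 15 \<in> cubie_perms"
  by (rule word_cubie_perm[where w = "[(l3, 3), (f3, 1), (l3, 1), (r3, 3), (u3, 2), (r3, 1), (l3, 3), (f3, 1), (l3, 1)]"],
      simp add: cube_moves_def, simp, simp only: word_eval, simp add: transpose_def)

lemma edge_cycle_16: "transpose 8 9 \<circ> transpose 8 16 \<in> cubie_perms"
  by (rule word_cubie_perm[where w = "[(b3, 2), (d3, 3), (f3, 3), (b3, 1), (l3, 2), (f3, 1), (b3, 3), (d3, 3), (b3, 2)]"],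
      simp add: cube_moves_def, simp, simp only: word_eval, simp add: transpose_def)

lemma edge_cycle_17: "transpose 8 9 \<circ> transpose 8 17 \<in> cubie_perms"
  by (rule word_cubie_perm[where w = "[(r3, 2), (l3, 3), (f3, 1), (l3, 1), (r3, 3), (u3, 2), (r3, 1), (l3, 3), (f3, 1),
      (l3, 1), (r3, 2)]"],
      simp add: cube_moves_def, simp, simp only: word_eval, simp add: transpose_def)

lemma edge_cycle_18: "transpose 8 9 \<circ> transpose 8 18 \<in> cubie_perms"
  by (rule word_cubie_perm[where w = "[(l3, 2), (d3, 3), (l3, 3), (r3, 1), (b3, 2), (l3, 1), (r3, 3), (d3, 3), (l3, 2)]"],
      simp add: cube_moves_def, simp, simp only: word_eval, simp add: transpose_def)

lemma edge_cycle_19: "transpose 8 9 \<circ> transpose 8 19 \<in> cubie_perms"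
  by (rule word_cubie_perm[where w = "[(l3, 3), (b3, 3), (u3, 1), (d3, 3), (l3, 2), (d3, 1), (u3, 3), (b3, 3), (l3, 1)]"],
      simp add: cube_moves_def, simp, simp only: word_eval, simp add: transpose_def)

text \<open>The word is the commutator of \<open>u3^-1 r3^-1 u3\<close> with \<open>l3^-1\<close>,
  followed in the list by the word of \<open>corner_cycle_4\<close>; the adjacent letters
  \<open>l3\<close> merge into a half turn. The two three-cycles cancel on positions but not on
  orientations.\<close>

lemma corner_twist: "twist_pair 0 1 \<in> G3"
  by (rule word_twist_pair[where w = "[(u3, 3), (r3, 3), (u3, 1), (l3, 3), (u3, 3), (r3, 1), (u3, 1), (l3, 2), (d3, 1),
      (l3, 3), (u3, 1), (l3, 1), (d3, 3), (l3, 3), (u3, 3)]"],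
      simp add: cube_moves_def, simp only: word_eval, simp_all del: One_nat_def add: sticker_eval)

text \<open>Two edge words are multiplied: a conjugate of the pattern by \<open>l3^2 d3\<close>, and
  the inverse of the word of \<open>edge_cycle_15\<close>. Their position cycles cancel and two
  flips remain.\<close>

lemma edge_flip: "twist_pair 8 9 \<in> G3"
  by (rule word_twist_pair[where w = "[(l3, 2), (d3, 1), (b3, 3), (u3, 3), (d3, 1), (r3, 2), (u3, 1), (d3, 3), (b3, 3),
      (d3, 3), (l3, 1), (f3, 3), (l3, 1), (r3, 3), (u3, 2), (r3, 1), (l3, 3), (f3, 3),
      (l3, 1)]"],
      simp add: cube_moves_def, simp only: word_eval, simp_all del: One_nat_def add: sticker_eval)

subsection \<open>Eigenvectors of commuting matrices\<close>

text \<open>Apply \<open>M l\<close> to a vanishing combination and subtract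
  \<open>\<chi> j l\<close> times it: the \<open>j\<close> term disappears and the others acquire
  the factors \<open>\<chi> i l - \<chi> j l\<close>. By induction all these products vanish, for
  every \<open>l\<close>, so a different \<open>l\<close> may separate each pair.\<close>

lemma distinct_weights_independent:
  fixes v :: "'i \<Rightarrow> 'a::field vec"
  assumes "finite I" and M: "\<And>l. l \<in> L \<Longrightarrow> M l \<in> carrier_mat n n"
    and v: "\<And>i. i \<in> I \<Longrightarrow> v i \<in> carrier_vec n \<and> v i \<noteq> 0\<^sub>v n"
    and eig: "\<And>i l. i \<in> I \<Longrightarrow> l \<in> L \<Longrightarrow> M l *\<^sub>v v i = \<chi> i l \<cdot>\<^sub>v v i"
    and sep: "\<And>i j. i \<in> I \<Longrightarrow> j \<in> I \<Longrightarrow> i \<noteq> j \<Longrightarrow> \<exists>l\<in>L. \<chi> i l \<noteq> \<chi> j l"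
    and c: "\<And>k. k < n \<Longrightarrow> (\<Sum>i\<in>I. c i * v i $ k) = 0"
  shows "\<forall>i\<in>I. c i = 0"
  using assms(1) v eig sep c
proof (induction I arbitrary: c rule: finite_induct)
  case (insert j I)
  have I: "c i * (\<chi> i l - \<chi> j l) = 0" if "i \<in> I" "l \<in> L" for i l
  proof -
    have B: "M l \<in> carrier_mat n n" using M that by auto
    have "(\<Sum>i\<in>I. (c i * (\<chi> i l - \<chi> j l)) * v i $ k) = 0" if k: "k < n" for k
    proof -
      have Bv: "(\<Sum>q<n. M l $$ (k, q) * v i $ q) = \<chi> i l * v i $ k" if "i \<in> insert j I" for i
      proof -
        have vi: "dim_vec (v i) = n" using insert.prems(1)[OF that] by auto
        have "(M l *\<^sub>v v i) $ k = (\<Sum>q<n. M l $$ (k, q) * v i $ q)"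
          using B k vi by (auto simp: scalar_prod_def atLeast0LessThan intro!: sum.cong)
        then show ?thesis using insert.prems(2)[OF that \<open>l \<in> L\<close>] k vi by simp
      qed
      have "0 = (\<Sum>q<n. M l $$ (k, q) * (\<Sum>i\<in>insert j I. c i * v i $ q))" using insert.prems(4) by simp
      also have "\<dots> = (\<Sum>i\<in>insert j I. \<Sum>q<n. M l $$ (k, q) * (c i * v i $ q))"
        unfolding sum_distrib_left by (rule sum.swap)
      also have "\<dots> = (\<Sum>i\<in>insert j I. c i * (\<chi> i l * v i $ k))"
        by (intro sum.cong refl) (simp only: Bv[symmetric] sum_distrib_left mult.left_commute)
      finally have 1: "(\<Sum>i\<in>insert j I. c i * (\<chi> i l * v i $ k)) = 0" by simp
      have 2: "\<chi> j l * (\<Sum>i\<in>insert j I. c i * v i $ k) = 0" using insert.prems(4)[OF k] by simp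
      have "(\<Sum>i\<in>insert j I. (c i * (\<chi> i l - \<chi> j l)) * v i $ k) =
          (\<Sum>i\<in>insert j I. c i * (\<chi> i l * v i $ k)) - \<chi> j l * (\<Sum>i\<in>insert j I. c i * v i $ k)"
        by (simp only: sum_distrib_left sum_subtractf[symmetric]) (simp add: algebra_simps)
      then have "(\<Sum>i\<in>insert j I. (c i * (\<chi> i l - \<chi> j l)) * v i $ k) = 0" using 1 2 by simp
      then show ?thesis using insert.hyps by simp
    qed
    then show ?thesis
      using insert.IH[of "\<lambda>i. c i * (\<chi> i l - \<chi> j l)"] insert.prems(1-3) that by auto
  qed
  have cI: "c i = 0" if i: "i \<in> I" for i
  proof -
    have "i \<noteq> j" using i insert.hyps by auto
    then obtain l where "l \<in> L" "\<chi> i l \<noteq> \<chi> j l" using insert.prems(3)[of i j] i by blast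
    then show ?thesis using I[OF i] by auto
  qed
  have "c j = 0"
  proof (rule ccontr)
    assume "c j \<noteq> 0"
    have "v j $ k = 0" if "k < n" for k
    proof -
      have "(\<Sum>i\<in>I. c i * v i $ k) = 0" by (rule sum.neutral) (simp add: cI)
      then show ?thesis using insert.prems(4)[OF that] insert.hyps \<open>c j \<noteq> 0\<close> by simp
    qed
    then have "v j = 0\<^sub>v n" using insert.prems(1)[of j] by (intro eq_vecI) auto
    then show False using insert.prems(1)[of j] by auto
  qed
  then show ?case using cI by auto
qed simp

lemma distinct_weights_card_le:
  fixes v :: "'i \<Rightarrow> 'a::field vec"
  assumes fin: "finite I" and B: "\<And>l. l \<in> L \<Longrightarrow> B l \<in> carrier_mat n n"
    and v: "\<And>i. i \<in> I \<Longrightarrow> v i \<in> carrier_vec n \<and> v i \<noteq> 0\<^sub>v n"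
    and eig: "\<And>i l. i \<in> I \<Longrightarrow> l \<in> L \<Longrightarrow> B l *\<^sub>v v i = \<chi> i l \<cdot>\<^sub>v v i"
    and sep: "\<And>i j. i \<in> I \<Longrightarrow> j \<in> I \<Longrightarrow> i \<noteq> j \<Longrightarrow> \<exists>l\<in>L. \<chi> i l \<noteq> \<chi> j l"
  shows "card I \<le> n"
proof (rule ccontr)
  assume less: "\<not> card I \<le> n"
  define m where "m = card I"
  obtain h where h: "bij_betw h {..<m} I"
    using ex_bij_betw_nat_finite[OF fin] by (auto simp: m_def atLeast0LessThan)
  \<comment> \<open>The vectors are the columns, padded with zeros to a square matrix. With more
    vectors than coordinates row \<open>n\<close> is zero, so the determinant vanishes and a kernel
    vector is a linear relation.\<close>
  define M where "M = mat m m (\<lambda>(k, j). if k < n then v (h j) $ k else 0)"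
  have M: "M \<in> carrier_mat m m" by (simp add: M_def)
  have "det M = 0"
  proof -
    have "M = mat\<^sub>r m m (\<lambda>i. if i = n then 0\<^sub>v m else row M i)"
      using less by (intro eq_matI) (auto simp: M_def m_def)
    then show ?thesis
      using det_row_0[of n m "row M"] less M by (simp add: m_def)
  qed
  then obtain w where w: "w \<in> carrier_vec m" "w \<noteq> 0\<^sub>v m" "M *\<^sub>v w = 0\<^sub>v m"
    using det_0_iff_vec_prod_zero[OF M] by blast
  define c where "c i = w $ (inv_into {..<m} h i)" for i
  have "(\<Sum>i\<in>I. c i * v i $ k) = 0" if "k < n" for k
  proof -
    have k: "k < m" using that less m_def by simp
    have "(\<Sum>i\<in>I. c i * v i $ k) = (\<Sum>j<m. c (h j) * v (h j) $ k)"
      by (rule sum.reindex_bij_betw[OF h, symmetric])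
    also have "\<dots> = (\<Sum>j<m. M $$ (k, j) * w $ j)"
      using h k that by (intro sum.cong) (auto simp: M_def c_def bij_betw_inv_into_left)
    also have "\<dots> = (M *\<^sub>v w) $ k"
      using k w(1) M by (auto simp: scalar_prod_def atLeast0LessThan intro!: sum.cong)
    finally show ?thesis using w(3) k by simp
  qed
  with fin B v eig sep have c0: "\<forall>i\<in>I. c i = 0"
    by (rule distinct_weights_independent[where M = B and L = L])
  have "w $ j = 0" if "j < m" for j
    using c0 bspec[OF c0, of "h j"] h that by (auto simp: c_def bij_betw_inv_into_left bij_betwE)
  then have "w = 0\<^sub>v m" using w(1) by (intro eq_vecI) auto
  then show False using w(2) by simp
qed

text \<open>The product of the factors \<open>A - z\<close> over the list annihilates
  \<open>v\<close>. An annihilating polynomial given by its roots produces eigenvectors over any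
  field.\<close>

definition killed_by :: "'a::field mat \<Rightarrow> 'a list \<Rightarrow> 'a vec \<Rightarrow> bool" where
  "killed_by A zs v \<longleftrightarrow> foldl (\<lambda>u z. A *\<^sub>v u - z \<cdot>\<^sub>v u) v zs = 0\<^sub>v (dim_vec v)"

text \<open>The last nonzero partial product is an eigenvector \<open>w = p(A) v\<close>. Being a
  polynomial in \<open>A\<close> applied to \<open>v\<close>, it inherits every eigenvalue of
  \<open>v\<close> under matrices commuting with \<open>A\<close>; this is what allows iteration
  over a commuting family.\<close>

lemma killed_by_eigenvector:
  fixes A :: "'a::field mat"
  assumes "A \<in> carrier_mat n n" "v \<in> carrier_vec n" "v \<noteq> 0\<^sub>v n" "killed_by A zs v"
  shows "\<exists>w\<in>carrier_vec n. \<exists>\<zeta>\<in>set zs. w \<noteq> 0\<^sub>v n \<and> A *\<^sub>v w = \<zeta> \<cdot>\<^sub>v w \<and>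
    (\<forall>B\<in>carrier_mat n n. \<forall>\<mu>. A * B = B * A \<longrightarrow> B *\<^sub>v v = \<mu> \<cdot>\<^sub>v v \<longrightarrow> B *\<^sub>v w = \<mu> \<cdot>\<^sub>v w)"
  using assms(2-)
proof (induction zs arbitrary: v)
  case Nil
  then show ?case by (simp add: killed_by_def)
next
  case (Cons z zs)
  note A = assms(1)
  define u where "u = A *\<^sub>v v - z \<cdot>\<^sub>v v"
  have u: "u \<in> carrier_vec n" using A Cons.prems by (auto simp: u_def)
  show ?case
  proof (cases "u = 0\<^sub>v n")
    case True
    have "A *\<^sub>v v = z \<cdot>\<^sub>v v"
    proof (rule eq_vecI)
      fix k assume "k < dim_vec (z \<cdot>\<^sub>v v)"
      then show "(A *\<^sub>v v) $ k = (z \<cdot>\<^sub>v v) $ k"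
        using arg_cong[OF True, of "\<lambda>x. x $ k"] A Cons.prems(1) by (simp add: u_def)
    qed (use A Cons.prems in auto)
    then show ?thesis using Cons.prems by (intro bexI[of _ v] bexI[of _ z]) auto
  next
    case False
    have "killed_by A zs u" using Cons.prems u by (simp add: killed_by_def u_def)
    from Cons.IH[OF u False this] obtain w \<zeta> where w: "w \<in> carrier_vec n" "\<zeta> \<in> set zs" "w \<noteq> 0\<^sub>v n"
        "A *\<^sub>v w = \<zeta> \<cdot>\<^sub>v w"
      and B: "\<And>B \<mu>. B \<in> carrier_mat n n \<Longrightarrow> A * B = B * A \<Longrightarrow> B *\<^sub>v u = \<mu> \<cdot>\<^sub>v u \<Longrightarrow> B *\<^sub>v w = \<mu> \<cdot>\<^sub>v w" by blast
    have "B *\<^sub>v w = \<mu> \<cdot>\<^sub>v w" if "B \<in> carrier_mat n n" "A * B = B * A" "B *\<^sub>v v = \<mu> \<cdot>\<^sub>v v" for B \<mu>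
    proof (rule B[OF that(1,2)])
      have "B *\<^sub>v u = B *\<^sub>v (A *\<^sub>v v) - B *\<^sub>v (z \<cdot>\<^sub>v v)"
        unfolding u_def using A that Cons.prems(1) by (intro mult_minus_distrib_mat_vec) auto
      also have "B *\<^sub>v (A *\<^sub>v v) = A *\<^sub>v (B *\<^sub>v v)"
        using A that(1,2) Cons.prems(1) by (metis assoc_mult_mat_vec)
      also have "\<dots> = \<mu> \<cdot>\<^sub>v (A *\<^sub>v v)" unfolding that(3) by (rule mult_mat_vec[OF A Cons.prems(1)])
      also have "B *\<^sub>v (z \<cdot>\<^sub>v v) = z \<cdot>\<^sub>v (\<mu> \<cdot>\<^sub>v v)" using mult_mat_vec[OF that(1) Cons.prems(1)] that(3) by simp
      also have "\<mu> \<cdot>\<^sub>v (A *\<^sub>v v) - z \<cdot>\<^sub>v (\<mu> \<cdot>\<^sub>v v) = \<mu> \<cdot>\<^sub>v u"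
        using A Cons.prems(1) by (intro eq_vecI) (auto simp: u_def algebra_simps)
      finally show "B *\<^sub>v u = \<mu> \<cdot>\<^sub>v u" .
    qed
    then show ?thesis using w by (intro bexI[of _ w] bexI[of _ \<zeta>]) auto
  qed
qed

text \<open>One matrix is treated at a time, and the inheritance clause preserves the eigenvalues
  already found. The same clause in the conclusion keeps a prescribed eigenvalue of the starting
  vector.\<close>

lemma joint_eigenvector:
  fixes \<A> :: "'a::field mat set"
  assumes "finite \<A>" "\<A> \<subseteq> carrier_mat n n"
    and "\<And>A B. A \<in> \<A> \<Longrightarrow> B \<in> \<A> \<Longrightarrow> A * B = B * A"
    and "\<And>A. A \<in> \<A> \<Longrightarrow> \<exists>zs. \<forall>v\<in>carrier_vec n. killed_by A zs v"
    and "v \<in> carrier_vec n" "v \<noteq> 0\<^sub>v n"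
  shows "\<exists>w\<in>carrier_vec n. w \<noteq> 0\<^sub>v n \<and> (\<forall>A\<in>\<A>. \<exists>\<zeta>. A *\<^sub>v w = \<zeta> \<cdot>\<^sub>v w) \<and>
    (\<forall>B\<in>carrier_mat n n. \<forall>\<mu>. (\<forall>A\<in>\<A>. A * B = B * A) \<longrightarrow> B *\<^sub>v v = \<mu> \<cdot>\<^sub>v v \<longrightarrow> B *\<^sub>v w = \<mu> \<cdot>\<^sub>v w)"
  using assms
proof (induction \<A> rule: finite_induct)
  case empty
  then show ?case by (intro bexI[of _ v]) auto
next
  case (insert A \<A>)
  obtain w where w: "w \<in> carrier_vec n" "w \<noteq> 0\<^sub>v n" "\<forall>A\<in>\<A>. \<exists>\<zeta>. A *\<^sub>v w = \<zeta> \<cdot>\<^sub>v w"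
    and Bw: "\<forall>B\<in>carrier_mat n n. \<forall>\<mu>. (\<forall>A\<in>\<A>. A * B = B * A) \<longrightarrow> B *\<^sub>v v = \<mu> \<cdot>\<^sub>v v \<longrightarrow> B *\<^sub>v w = \<mu> \<cdot>\<^sub>v w"
    using insert.IH insert.prems by (metis insert_iff insert_subset)
  obtain zs where "\<forall>v\<in>carrier_vec n. killed_by A zs v" using insert.prems(3) by blast
  then obtain u \<zeta> where u: "u \<in> carrier_vec n" "u \<noteq> 0\<^sub>v n" "A *\<^sub>v u = \<zeta> \<cdot>\<^sub>v u"
    and Bu: "\<And>B \<mu>. B \<in> carrier_mat n n \<Longrightarrow> A * B = B * A \<Longrightarrow> B *\<^sub>v w = \<mu> \<cdot>\<^sub>v w \<Longrightarrow> B *\<^sub>v u = \<mu> \<cdot>\<^sub>v u"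
    using killed_by_eigenvector[of A n w zs] w insert.prems(1) by auto
  have "\<exists>\<zeta>. A' *\<^sub>v u = \<zeta> \<cdot>\<^sub>v u" if "A' \<in> insert A \<A>" for A'
    using that u(3) w(3) Bu[of A'] insert.prems(1,2) by (cases "A' = A") (auto, blast)
  then show ?case using u Bw Bu by (intro bexI[of _ u]) auto
qed

text \<open>Some unit vector is moved by \<open>A\<close>; its image under \<open>A - 1\<close> is
  nonzero and is annihilated by the remaining factors. So the eigenvalue comes from
  \<open>zs\<close> and not from the leading root 1.\<close>

lemma killed_by_eigenvector_nontrivial:
  fixes A :: "'a::field mat"
  assumes A: "A \<in> carrier_mat n n" and "A \<noteq> 1\<^sub>m n" and kill: "\<And>v. v \<in> carrier_vec n \<Longrightarrow> killed_by A (1 # zs) v"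
  shows "\<exists>v\<in>carrier_vec n. \<exists>\<zeta>\<in>set zs. v \<noteq> 0\<^sub>v n \<and> A *\<^sub>v v = \<zeta> \<cdot>\<^sub>v v"
proof -
  obtain j where j: "j < n" "A *\<^sub>v unit_vec n j \<noteq> unit_vec n j"
  proof (rule ccontr)
    assume "\<not> thesis"
    then have fixed: "\<And>j. j < n \<Longrightarrow> A *\<^sub>v unit_vec n j = unit_vec n j" using that by blast
    have "A = 1\<^sub>m n"
    proof (rule eq_matI)
      fix i j assume "i < dim_row (1\<^sub>m n :: 'a mat)" "j < dim_col (1\<^sub>m n :: 'a mat)"
      then show "A $$ (i, j) = 1\<^sub>m n $$ (i, j)"
        using arg_cong[OF fixed[of j], of "\<lambda>x. x $ i"] A by simp
    qed (use A in auto)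
    then show False using assms by simp
  qed
  define u where "u = A *\<^sub>v unit_vec n j - 1 \<cdot>\<^sub>v unit_vec n j"
  have u: "u \<in> carrier_vec n" using A by (simp add: u_def)
  have "u \<noteq> 0\<^sub>v n"
  proof
    assume u0: "u = 0\<^sub>v n"
    have "A *\<^sub>v unit_vec n j = unit_vec n j"
    proof (rule eq_vecI)
      fix k assume "k < dim_vec (unit_vec n j :: 'a vec)"
      then show "(A *\<^sub>v unit_vec n j) $ k = unit_vec n j $ k"
        using arg_cong[OF u0, of "\<lambda>x. x $ k"] A by (simp add: u_def)
    qed (use A in auto)
    then show False using j by simp
  qed
  moreover have "killed_by A zs u" using kill[of "unit_vec n j"] u by (simp add: killed_by_def u_def)
  ultimately show ?thesis using killed_by_eigenvector[OF A u] by blast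
qed

lemma killed_by_order_2:
  fixes A :: "'a::field mat"
  assumes A: "A \<in> carrier_mat n n" and "A * A = 1\<^sub>m n" and v: "v \<in> carrier_vec n"
  shows "killed_by A [1, -1] v"
proof -
  have AAv: "A *\<^sub>v (A *\<^sub>v v) = v" using assms by (metis assoc_mult_mat_vec one_mult_mat_vec)
  have "A *\<^sub>v (A *\<^sub>v v - 1 \<cdot>\<^sub>v v) = A *\<^sub>v (A *\<^sub>v v) - A *\<^sub>v v"
    using mult_minus_distrib_mat_vec[OF A, of "A *\<^sub>v v" v] A v by simp
  then show ?thesis unfolding killed_by_def using A v AAv by (intro eq_vecI) auto
qed

text \<open>When \<open>\<omega>\<close> is a root of \<open>X^2 + X + 1\<close>, the polynomial
  \<open>X^3 - 1\<close> has the roots 1, \<open>\<omega>\<close> and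
  \<open>\<omega> * \<omega>\<close>.\<close>

lemma killed_by_order_3:
  fixes A :: "'a::field mat"
  assumes A: "A \<in> carrier_mat n n" and "A * A * A = 1\<^sub>m n" and v: "v \<in> carrier_vec n"
    and \<omega>: "\<omega> * \<omega> + \<omega> + 1 = 0"
  shows "killed_by A [1, \<omega>, \<omega> * \<omega>] v"
proof -
  define b where "b = A *\<^sub>v v"
  define c where "c = A *\<^sub>v b"
  have bc: "b \<in> carrier_vec n" "c \<in> carrier_vec n" using A v by (auto simp: b_def c_def)
  have Ac: "A *\<^sub>v c = v"
  proof -
    have "A *\<^sub>v c = A * A * A *\<^sub>v v"
      using assoc_mult_mat_vec[of "A * A" n n A n v] assoc_mult_mat_vec[of A n n A n "A *\<^sub>v v"] A v
      by (simp add: b_def c_def)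
    then show ?thesis using assms by simp
  qed
  define u where "u = b - v"
  have u: "u \<in> carrier_vec n" using bc v by (simp add: u_def)
  have Au: "A *\<^sub>v u = c - b" using mult_minus_distrib_mat_vec[OF A bc(1) v] by (simp add: u_def b_def c_def)
  define x where "x = (c - b) - \<omega> \<cdot>\<^sub>v u"
  have "A *\<^sub>v x = (v - c) - \<omega> \<cdot>\<^sub>v (c - b)"
    using mult_minus_distrib_mat_vec[OF A, of "c - b" "\<omega> \<cdot>\<^sub>v u"] mult_minus_distrib_mat_vec[OF A bc(2,1)]
      mult_mat_vec[OF A u, of \<omega>] u bc v by (simp add: x_def Au Ac c_def[symmetric])
  then have "A *\<^sub>v x - (\<omega> * \<omega>) \<cdot>\<^sub>v x = 0\<^sub>v n"
  proof (intro eq_vecI)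
    fix k assume "k < dim_vec (0\<^sub>v n :: 'a vec)"
    then have k: "k < n" by simp
    have w: "\<omega> * \<omega> = - 1 - \<omega>" using \<omega> by (simp add: eq_neg_iff_add_eq_0 algebra_simps)
    have "\<omega> * (\<omega> * \<omega>) = \<omega> * (- 1 - \<omega>)" by (simp only: w)
    also have "\<dots> = - \<omega> - \<omega> * \<omega>" by (simp add: algebra_simps)
    finally have w3: "\<omega> * (\<omega> * \<omega>) = 1" by (simp add: w)
    have "(A *\<^sub>v x - (\<omega> * \<omega>) \<cdot>\<^sub>v x) $ k = ((v $ k - c $ k) - \<omega> * (c $ k - b $ k)) -
        (\<omega> * \<omega>) * ((c $ k - b $ k) - \<omega> * (b $ k - v $ k))"
      using \<open>A *\<^sub>v x = _\<close> k bc v u by (simp add: x_def u_def)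
    also have "\<dots> = (v $ k - \<omega> * (\<omega> * \<omega>) * v $ k) - (1 + \<omega> + \<omega> * \<omega>) * c $ k
        + (\<omega> + \<omega> * \<omega> + \<omega> * (\<omega> * \<omega>)) * b $ k"
      by (simp add: algebra_simps)
    also have "\<dots> = 0" unfolding w3 by (simp add: w)
    finally show "(A *\<^sub>v x - (\<omega> * \<omega>) \<cdot>\<^sub>v x) $ k = 0\<^sub>v n $ k" using k by simp
  qed (use bc v in \<open>simp add: x_def u_def\<close>)
  moreover have "foldl (\<lambda>u z. A *\<^sub>v u - z \<cdot>\<^sub>v u) v [1, \<omega>, \<omega> * \<omega>] = A *\<^sub>v x - (\<omega> * \<omega>) \<cdot>\<^sub>v x"
    by (simp add: b_def[symmetric] u_def[symmetric] Au x_def)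
  ultimately show ?thesis using v by (simp add: killed_by_def)
qed

subsection \<open>Rearrangements of nonconstant functions\<close>

lemma permutes_subset_image:
  assumes "finite W" "S \<subseteq> W" "T \<subseteq> W" "card S = card T"
  shows "\<exists>\<pi>. \<pi> permutes W \<and> (\<forall>w\<in>W. \<pi> w \<in> S \<longleftrightarrow> w \<in> T)"
proof -
  have fin: "finite S" "finite T" using assms finite_subset by auto
  obtain h where h: "bij_betw h T S" using finite_same_card_bij[OF fin(2,1)] assms by auto
  have "card (W - T) = card (W - S)" using assms fin by (simp add: card_Diff_subset)
  then obtain h' where h': "bij_betw h' (W - T) (W - S)"
    using finite_same_card_bij[of "W - T" "W - S"] assms by auto
  define \<pi> where "\<pi> w = (if w \<in> T then h w else if w \<in> W then h' w else w)" for w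
  have 1: "bij_betw \<pi> T S" using h by (subst bij_betw_cong[of _ _ h]) (auto simp: \<pi>_def)
  have 2: "bij_betw \<pi> (W - T) (W - S)" using h' by (subst bij_betw_cong[of _ _ h']) (auto simp: \<pi>_def)
  have "bij_betw \<pi> (T \<union> (W - T)) (S \<union> (W - S))" by (rule bij_betw_combine[OF 1 2]) auto
  moreover have "T \<union> (W - T) = W" "S \<union> (W - S) = W" using assms by auto
  ultimately have "bij_betw \<pi> W W" by simp
  then have "\<pi> permutes W" by (rule bij_imp_permutes) (use assms in \<open>auto simp: \<pi>_def\<close>)
  moreover have "\<pi> w \<in> S \<longleftrightarrow> w \<in> T" if "w \<in> W" for w
    using that bij_betwE[OF 1] bij_betwE[OF 2] by auto
  ultimately show ?thesis by blast
qed

lemma large_fiber: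
  assumes "finite D" "finite Z" "x ` D \<subseteq> Z" "card Z * k < card D"
  shows "\<exists>b\<in>x ` D. k < card {i \<in> D. x i = b}"
proof (rule ccontr)
  assume "\<not> ?thesis"
  then have le: "card {i \<in> D. x i = b} \<le> k" if "b \<in> x ` D" for b using that by (meson leI)
  have fin: "finite (x ` D)" using assms by simp
  have "D = (\<Union>b\<in>x ` D. {i \<in> D. x i = b})" by auto
  then have "card D \<le> (\<Sum>b\<in>x ` D. card {i \<in> D. x i = b})"
    using card_UN_le[OF fin, of "\<lambda>b. {i \<in> D. x i = b}"] by simp
  also have "\<dots> \<le> card (x ` D) * k" using sum_bounded_above[of "x ` D" _ k] le by auto
  also have "\<dots> \<le> card Z * k" using card_mono[OF assms(2,3)] by simp
  finally show False using assms(4) by simp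
qed

text \<open>Many rearrangements of a nonconstant function are told apart by the position of one or two
  exceptional values inside a window \<open>W\<close> that is mostly filled with a fixed value \<open>b\<close>; requiring a
  majority of \<open>b\<close> in \<open>W\<close> makes the rearrangements distinct even up to scaling.\<close>
lemma many_rearrangements:
  fixes x :: "nat \<Rightarrow> 'b"
  assumes D: "finite D" and Z: "finite Z" "x ` D \<subseteq> Z" "card Z * k < card D"
    and k: "2 \<le> k" "card D \<le> (k + 3) choose 2" and nonconst: "i \<in> D" "j \<in> D" "x i \<noteq> x j"
  obtains b W \<T> p where "b \<in> x ` D" "W \<subseteq> D" "finite \<T>" "card D \<le> card \<T>"
    "\<forall>T\<in>\<T>. T \<subseteq> W \<and> T \<noteq> {} \<and> 2 * card T < card W"
    "\<forall>T\<in>\<T>. p T permutes D" "\<forall>T\<in>\<T>. \<forall>w\<in>W. x (p T w) = b \<longleftrightarrow> w \<notin> T"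
proof -
  obtain b where b: "b \<in> x ` D" "k < card {i \<in> D. x i = b}" using large_fiber[OF D Z] by blast
  define F where "F = {i \<in> D. x i = b}"
  have F: "F \<subseteq> D" "finite F" "k < card F" using D b by (auto simp: F_def)
  have ne: "D - F \<noteq> {}" using nonconst by (auto simp: F_def)
  have "\<exists>S W. S \<subseteq> W \<and> W \<subseteq> D \<and> S \<noteq> {} \<and> 2 * card S < card W \<and> (\<forall>w\<in>W. w \<in> F \<longleftrightarrow> w \<notin> S) \<and>
      card D \<le> card W choose card S"
  proof (cases "card (D - F) = 1")
    case True
    have "card D = card F + 1" using True F D by (simp add: card_Diff_subset)
    then show ?thesis using True F ne k
      by (intro exI[of _ "D - F"] exI[of _ D]) auto
  next
    case False
    then have "2 \<le> card (D - F)" using ne D by (metis One_nat_def Suc_1 card_0_eq finite_Diff not_less_eq_eq le_Suc_eq le_zero_eq)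
    then obtain S where S: "S \<subseteq> D - F" "card S = 2" using obtain_subset_with_card_n by metis
    obtain K where K: "K \<subseteq> F" "card K = Suc k" using F(3) by (metis Suc_leI obtain_subset_with_card_n)
    have "card (S \<union> K) = k + 3" using S K F D
      by (subst card_Un_disjoint) (auto intro: finite_subset)
    then show ?thesis using S K F k by (intro exI[of _ S] exI[of _ "S \<union> K"]) auto
  qed
  then obtain S W where W: "S \<subseteq> W" "W \<subseteq> D" "S \<noteq> {}" "2 * card S < card W" "\<And>w. w \<in> W \<Longrightarrow> w \<in> F \<longleftrightarrow> w \<notin> S"
    "card D \<le> card W choose card S" by metis
  have fin: "finite W" "finite S"
    using finite_subset[OF W(2) D] finite_subset[OF W(1)] by auto
  define \<T> where "\<T> = {T. T \<subseteq> W \<and> card T = card S}"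
  have "card D \<le> card \<T>" using W(6) n_subsets[OF fin(1), of "card S"] by (simp add: \<T>_def)
  moreover have "finite \<T>" using fin by (simp add: \<T>_def)
  moreover have ex: "\<forall>T\<in>\<T>. \<exists>\<pi>. \<pi> permutes D \<and> (\<forall>w\<in>W. x (\<pi> w) = b \<longleftrightarrow> w \<notin> T)"
  proof
    fix T assume "T \<in> \<T>"
    then obtain \<pi> where \<pi>: "\<pi> permutes W" "\<forall>w\<in>W. \<pi> w \<in> S \<longleftrightarrow> w \<in> T"
      using permutes_subset_image[OF fin(1) W(1), of T] by (auto simp: \<T>_def)
    have "x (\<pi> w) = b \<longleftrightarrow> w \<notin> T" if "w \<in> W" for w
    proof -
      have "\<pi> w \<in> W" using that permutes_in_image[OF \<pi>(1)] by simp
      then have "x (\<pi> w) = b \<longleftrightarrow> \<pi> w \<in> F" using W(2) by (auto simp: F_def)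
      then show ?thesis using W(5)[OF \<open>\<pi> w \<in> W\<close>] \<pi>(2) that by simp
    qed
    then show "\<exists>\<pi>. \<pi> permutes D \<and> (\<forall>w\<in>W. x (\<pi> w) = b \<longleftrightarrow> w \<notin> T)"
      using permutes_subset[OF \<pi>(1) W(2)] by blast
  qed
  moreover from bchoice[OF ex] obtain p
    where "\<forall>T\<in>\<T>. p T permutes D \<and> (\<forall>w\<in>W. x (p T w) = b \<longleftrightarrow> w \<notin> T)" ..
  moreover have "\<forall>T\<in>\<T>. T \<subseteq> W \<and> T \<noteq> {} \<and> 2 * card T < card W"
    using W(3,4) fin by (auto simp: \<T>_def)
  ultimately show thesis using b(1) W(2) by (intro that[of b W \<T> p]) simp_all
qed

text \<open>At such a point two rearrangements both take the majority value; dividing by it removes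
  an unknown common scalar.\<close>

lemma common_majority_point:
  assumes "finite W" "T \<subseteq> W" "T' \<subseteq> W" "2 * card T < card W" "2 * card T' < card W"
  shows "\<exists>w\<in>W. w \<notin> T \<and> w \<notin> T'"
proof -
  have "card (T \<union> T') < card W" using card_Un_le[of T T'] assms(4,5) by simp
  then have "\<not> W \<subseteq> T \<union> T'" using assms by (metis card_mono finite_UnI finite_subset not_less)
  then show ?thesis by blast
qed

text \<open>Even permutations of a finite set are compositions of an even number of the transpositions
  \<open>transpose a k\<close>.\<close>
lemma permutes_even_or_odd:
  assumes D: "finite D" "a \<in> D" "b \<in> D" "a \<noteq> b"
    and E: "id \<in> E" "\<And>\<pi> \<pi>'. \<pi> \<in> E \<Longrightarrow> \<pi>' \<in> E \<Longrightarrow> \<pi> \<circ> \<pi>' \<in> E" "\<And>\<pi>. \<pi> \<in> E \<Longrightarrow> Hilbert_Choice.inv \<pi> \<in> E"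
    and cyc: "\<And>k. k \<in> D \<Longrightarrow> k \<noteq> a \<Longrightarrow> k \<noteq> b \<Longrightarrow> transpose a b \<circ> transpose a k \<in> E"
  defines "Od \<equiv> {\<pi>. transpose a b \<circ> \<pi> \<in> E}"
  shows "\<pi> permutes D \<Longrightarrow> \<pi> \<in> E \<union> Od"
    and "\<And>i j \<pi>. i \<in> D \<Longrightarrow> j \<in> D \<Longrightarrow> i \<noteq> j \<Longrightarrow> \<pi> \<in> Od \<Longrightarrow> transpose i j \<circ> \<pi> \<in> E"
proof -
  have star: "(\<pi> \<in> E \<longrightarrow> transpose a k \<circ> \<pi> \<in> Od) \<and> (\<pi> \<in> Od \<longrightarrow> transpose a k \<circ> \<pi> \<in> E)"
    if k: "k \<in> D" "k \<noteq> a" for k \<pi>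
  proof (cases "k = b")
    case True
    then show ?thesis by (simp add: Od_def o_assoc)
  next
    case False
    then have c: "transpose a b \<circ> transpose a k \<in> E" using cyc k by blast
    \<comment> \<open>The three-cycle carries \<open>E\<close> to \<open>Od\<close>; its inverse is
      needed for the way back.\<close>
    have "Hilbert_Choice.inv (transpose a b \<circ> transpose a k) = transpose a k \<circ> transpose a b"
      by (rule inv_unique_comp) (simp_all add: fun_eq_iff)
    then have c': "transpose a k \<circ> transpose a b \<in> E" using E(3)[OF c] by simp
    have "transpose a k \<circ> \<pi> = (transpose a k \<circ> transpose a b) \<circ> (transpose a b \<circ> \<pi>)"
      by (simp add: fun_eq_iff)
    then have "\<pi> \<in> Od \<Longrightarrow> transpose a k \<circ> \<pi> \<in> E"
      using E(2)[OF c', of "transpose a b \<circ> \<pi>"] by (simp only: Od_def mem_Collect_eq)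
    moreover have "\<pi> \<in> E \<Longrightarrow> transpose a k \<circ> \<pi> \<in> Od"
      using E(2)[OF c, of \<pi>] by (simp only: Od_def mem_Collect_eq o_assoc)
    ultimately show ?thesis by blast
  qed
  have step: "(\<pi> \<in> E \<longrightarrow> transpose i j \<circ> \<pi> \<in> Od) \<and> (\<pi> \<in> Od \<longrightarrow> transpose i j \<circ> \<pi> \<in> E)"
    if ij: "i \<in> D" "j \<in> D" "i \<noteq> j" for i j \<pi>
  proof -
    consider "i = a" | "j = a" | "i \<noteq> a" "j \<noteq> a" by blast
    then show ?thesis
    proof cases
      case 1 then show ?thesis using star[of j] ij by simp
    next
      case 2 then show ?thesis using star[of i] ij by (simp add: transpose_commute)
    next
      case 3
      \<comment> \<open>An arbitrary transposition is three transpositions through \<open>a\<close>,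
        again an odd number, so the class still changes.\<close>
      have "transpose i j \<circ> \<pi> = transpose a i \<circ> (transpose a j \<circ> (transpose a i \<circ> \<pi>))"
        using 3 ij by (auto simp: fun_eq_iff transpose_def)
      then show ?thesis using star[OF ij(1) 3(1)] star[OF ij(2) 3(2)] by metis
    qed
  qed
  show "i \<in> D \<Longrightarrow> j \<in> D \<Longrightarrow> i \<noteq> j \<Longrightarrow> \<pi> \<in> Od \<Longrightarrow> transpose i j \<circ> \<pi> \<in> E" for i j \<pi>
    using step by blast
  show "\<pi> \<in> E \<union> Od" if "\<pi> permutes D"
    using that D(1)
  proof (induction rule: permutes_induct)
    case (swap i j \<pi>)
    show ?case
    proof (cases "i = j")
      case True
      then have "transpose i j \<circ> \<pi> = \<pi>" by (simp add: fun_eq_iff)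
      then show ?thesis using swap by metis
    next
      case False
      then show ?thesis using step[of i j \<pi>] swap by blast
    qed
  qed (use E in blast)
qed

text \<open>A repeated value makes a transposition invisible, so closure under even permutations is enough.\<close>
lemma rearrangement_by_even:
  assumes D: "finite D" "a \<in> D" "b \<in> D" "a \<noteq> b"
    and E: "id \<in> E" "\<And>\<pi> \<pi>'. \<pi> \<in> E \<Longrightarrow> \<pi>' \<in> E \<Longrightarrow> \<pi> \<circ> \<pi>' \<in> E" "\<And>\<pi>. \<pi> \<in> E \<Longrightarrow> Hilbert_Choice.inv \<pi> \<in> E"
    and cyc: "\<And>k. k \<in> D \<Longrightarrow> k \<noteq> a \<Longrightarrow> k \<noteq> b \<Longrightarrow> transpose a b \<circ> transpose a k \<in> E"
    and x: "i \<in> D" "j \<in> D" "i \<noteq> j" "x i = x j" and \<pi>: "\<pi> permutes D"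
  shows "\<exists>\<pi>'\<in>E. x \<circ> \<pi> = x \<circ> \<pi>'"
proof (cases "\<pi> \<in> E")
  case False
  then have "transpose i j \<circ> \<pi> \<in> E"
    using permutes_even_or_odd[OF D E cyc] x(1-3) \<pi> by blast
  moreover have "x \<circ> (transpose i j \<circ> \<pi>) = x \<circ> \<pi>"
    using x(4) by (auto simp: fun_eq_iff transpose_def)
  ultimately show ?thesis by metis
qed blast

subsection \<open>Weights of a faithful representation\<close>

lemma corner_cycles:
  assumes "k < 8" "k \<noteq> 0" "k \<noteq> 1" shows "transpose 0 1 \<circ> transpose 0 k \<in> cubie_perms"
proof -
  have "k \<in> {2, 3, 4, 5, 6, 7}" using assms by auto
  then show ?thesis
    using corner_cycle_2 corner_cycle_3 corner_cycle_4 corner_cycle_5 corner_cycle_6 corner_cycle_7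
    by (elim insertE emptyE) simp_all
qed

lemma edge_cycles:
  assumes "k < 20" "8 \<le> k" "k \<noteq> 8" "k \<noteq> 9" shows "transpose 8 9 \<circ> transpose 8 k \<in> cubie_perms"
proof -
  have "k \<in> {10, 11, 12, 13, 14, 15, 16, 17, 18, 19}" using assms by simp arith
  then show ?thesis
    using edge_cycle_10 edge_cycle_11 edge_cycle_12 edge_cycle_13 edge_cycle_14 edge_cycle_15
      edge_cycle_16 edge_cycle_17 edge_cycle_18 edge_cycle_19
    by (elim insertE emptyE) simp_all
qed

lemma twist_pair_inverse_G3:
  assumes "twist_pair i j \<in> G3" shows "twist_pair j i \<in> G3"
proof -
  obtain h where h: "h \<in> G3" "h \<circ> twist_pair i j = id" using G3_inverse[OF assms] by blast
  have "h = h \<circ> (twist_pair i j \<circ> twist_pair j i)" by (simp add: twist_pair_comp twist_pair_same)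
  also have "\<dots> = twist_pair j i" using h(2) by (simp add: o_assoc)
  finally show ?thesis using h(1) by simp
qed

text \<open>The three-cycle maps \<open>a\<close> to \<open>k\<close> and \<open>b\<close> to
  \<open>a\<close>, so conjugation turns the pair \<open>(a, b)\<close> into \<open>(k, a)\<close>.
  Any two cubies are then joined through \<open>a\<close>.\<close>

lemma twist_pair_G3_block:
  assumes ab: "a \<noteq> b" "twist_pair a b \<in> G3"
    and cyc: "\<And>k. k \<in> D \<Longrightarrow> k \<noteq> a \<Longrightarrow> k \<noteq> b \<Longrightarrow> transpose a b \<circ> transpose a k \<in> cubie_perms"
    and ij: "i \<in> D" "j \<in> D"
  shows "twist_pair i j \<in> G3"
proof -
  have base: "twist_pair k a \<in> G3" if kD: "k \<in> D" for k
  proof -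
    consider "k = a" | "k = b" | "k \<noteq> a" "k \<noteq> b" by blast
    then show ?thesis
    proof cases
      case 1 then show ?thesis using G3_id by (simp add: twist_pair_same)
    next
      case 2 then show ?thesis using twist_pair_inverse_G3 ab by simp
    next
      case 3
      define \<pi> where "\<pi> = transpose a b \<circ> transpose a k"
      obtain g where g: "g \<in> G3" "\<And>z. cubie (g z) = \<pi> (cubie z)" and p: "\<pi> permutes {..<20}"
        using cyc[OF kD 3] by (auto simp: cubie_perms_def \<pi>_def)
      obtain h where h: "h \<in> G3" "g \<circ> h = id" using G3_inverse[OF g(1)] by blast
      have "\<pi> a = k" "\<pi> b = a" using 3 ab(1) by (auto simp: \<pi>_def transpose_def)
      then have "g \<circ> twist_pair a b = twist_pair k a \<circ> g"
        using twist_pair_conj[OF g(1) permutes_inj[OF p] g(2), of a b] by simp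
      then have "twist_pair k a = g \<circ> twist_pair a b \<circ> h" using h(2) by (metis comp_id o_assoc)
      then show ?thesis using G3_comp g(1) h(1) ab(2) by metis
    qed
  qed
  have "twist_pair i j = twist_pair i a \<circ> twist_pair a j" by (simp add: twist_pair_comp)
  then show ?thesis using base ij twist_pair_inverse_G3 G3_comp by metis
qed

text \<open>Corner twist and edge flip are conserved separately, so opposite rotations balance only
  within one kind.\<close>

definition same_kind :: "nat \<Rightarrow> nat \<Rightarrow> bool" where
  "same_kind i j \<longleftrightarrow> (i < 8 \<and> j < 8) \<or> (i \<in> {8..<20} \<and> j \<in> {8..<20})"

lemma twist_pair_G3: "same_kind i j \<Longrightarrow> twist_pair i j \<in> G3"
  unfolding same_kind_def
  using twist_pair_G3_block[of 0 1 "{..<8}" i j, OF _ corner_twist] corner_cycles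
    twist_pair_G3_block[of 8 9 "{8..<20}" i j, OF _ edge_flip] edge_cycles
  by auto

lemma cubie_perms_kind:
  assumes "\<pi> \<in> cubie_perms" "c < 20" shows "\<pi> c < 8 \<longleftrightarrow> c < 8" "\<pi> c < 20"
proof -
  obtain g where g: "g \<in> G3" "\<And>z. cubie (g z) = \<pi> (cubie z)" and p: "\<pi> permutes {..<20}"
    using assms by (auto simp: cubie_perms_def)
  have "\<pi> c = cubie (g (home c))" using g(2)[of "home c"] home_props(2)[OF assms(2)] by simp
  then show "\<pi> c < 8 \<longleftrightarrow> c < 8" using G3_corner[OF g(1), of "home c"] home_props(2)[OF assms(2)] by simp
  show "\<pi> c < 20" using permutes_in_image[OF p, of c] assms(2) by simp
qed

lemma same_kind_perm: "\<pi> \<in> cubie_perms \<Longrightarrow> same_kind i j \<Longrightarrow> same_kind (\<pi> i) (\<pi> j)"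
  using cubie_perms_kind[of \<pi> i] cubie_perms_kind[of \<pi> j] unfolding same_kind_def by auto

lemma invertible_matE:
  assumes "invertible_mat A" "A \<in> carrier_mat n n"
  obtains B where "B \<in> carrier_mat n n" "A * B = 1\<^sub>m n" "B * A = 1\<^sub>m n"
proof -
  obtain B where B: "A * B = 1\<^sub>m (dim_row A)" "B * A = 1\<^sub>m (dim_row B)"
    using assms(1) by (auto simp: invertible_mat_def inverts_mat_def)
  have "dim_col (A * B) = n" "dim_col (B * A) = dim_row B" using B assms(2) by auto
  then have "B \<in> carrier_mat n n" using assms(2) by auto
  then show ?thesis using that B assms(2) by auto
qed

lemma rep_id:
  assumes "is_rep G n \<rho>" "id \<in> G" shows "\<rho> id = 1\<^sub>m n"
proof -
  have M: "\<rho> id \<in> carrier_mat n n" "invertible_mat (\<rho> id)" "\<rho> id * \<rho> id = \<rho> id"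
    using assms by (auto simp: is_rep_def dest!: bspec[of G _ id])
  obtain B where B: "B \<in> carrier_mat n n" "\<rho> id * B = 1\<^sub>m n"
    using invertible_matE[OF M(2,1)] by metis
  have "\<rho> id = \<rho> id * (\<rho> id * B)" using B M by simp
  also have "\<dots> = (\<rho> id * \<rho> id) * B" by (rule assoc_mult_mat[symmetric]) (use B M in auto)
  finally show ?thesis using B(2) M(3) by simp
qed

text \<open>A character of the rotations in place, lifted to a function on cubies. The lift is
  unique only up to one scalar on the corners and one on the edges; taking its values among the
  roots of unity bounds their number by 3 and 2.\<close>

definition is_weight :: "((nat \<Rightarrow> nat) \<Rightarrow> complex mat) \<Rightarrow> nat \<Rightarrow> (nat \<Rightarrow> complex) \<Rightarrow> bool" where
  "is_weight \<rho> n x \<longleftrightarrow> (\<forall>i<8. x i ^ 3 = 1) \<and> (\<forall>i\<in>{8..<20}. x i ^ 2 = 1) \<and>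
     (\<exists>v\<in>carrier_vec n. v \<noteq> 0\<^sub>v n \<and>
        (\<forall>i j. same_kind i j \<longrightarrow> \<rho> (twist_pair i j) *\<^sub>v v = (x i / x j) \<cdot>\<^sub>v v))"

lemma is_weight_nonzero: "is_weight \<rho> n x \<Longrightarrow> i < 20 \<Longrightarrow> x i \<noteq> 0"
proof -
  assume "is_weight \<rho> n x" "i < 20"
  then have "x i ^ 3 = 1 \<or> x i ^ 2 = 1" by (cases "i < 8") (simp_all add: is_weight_def)
  then show "x i \<noteq> 0" by auto
qed

text \<open>If \<open>g\<close> induces \<open>\<pi>\<close>, applying the inverse of
  \<open>g\<close> to an eigenvector for \<open>x\<close> gives an eigenvector for
  \<open>x \<circ> \<pi>\<close>, by \<open>twist_pair_conj\<close>.\<close>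

lemma is_weight_perm:
  assumes rep: "is_rep G3 n \<rho>" and x: "is_weight \<rho> n x" and \<pi>: "\<pi> \<in> cubie_perms"
  shows "is_weight \<rho> n (x \<circ> \<pi>)"
proof -
  obtain v where v: "v \<in> carrier_vec n" "v \<noteq> 0\<^sub>v n"
    and eig: "\<And>i j. same_kind i j \<Longrightarrow> \<rho> (twist_pair i j) *\<^sub>v v = (x i / x j) \<cdot>\<^sub>v v"
    using x by (auto simp: is_weight_def)
  obtain g where g: "g \<in> G3" "\<And>z. cubie (g z) = \<pi> (cubie z)" and p: "\<pi> permutes {..<20}"
    using \<pi> by (auto simp: cubie_perms_def)
  obtain h where h: "h \<in> G3" "h \<circ> g = id" "g \<circ> h = id" using G3_inverse[OF g(1)] by blast
  have car: "\<rho> f \<in> carrier_mat n n" if "f \<in> G3" for f using rep that by (simp add: is_rep_def)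
  have hom: "\<rho> (f \<circ> f') = \<rho> f * \<rho> f'" if "f \<in> G3" "f' \<in> G3" for f f'
    using rep that by (simp add: is_rep_def)
  define u where "u = \<rho> h *\<^sub>v v"
  have u: "u \<in> carrier_vec n" using car[OF h(1)] v by (simp add: u_def)
  have "u \<noteq> 0\<^sub>v n"
  proof
    assume u0: "u = 0\<^sub>v n"
    have "\<rho> g *\<^sub>v u = (\<rho> g * \<rho> h) *\<^sub>v v"
      unfolding u_def by (rule assoc_mult_mat_vec[symmetric, OF car car]) (use g h v in auto)
    also have "\<rho> g * \<rho> h = 1\<^sub>m n" using hom[OF g(1) h(1)] h(3) rep_id[OF rep G3_id] by simp
    also have "1\<^sub>m n *\<^sub>v v = v" using v by simp
    finally show False using u0 v car[OF g(1)] by (metis mult_mat_vec_carrier mult_minus_distrib_mat_vec minus_cancel_vec)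
  qed
  moreover have "\<rho> (twist_pair i j) *\<^sub>v u = ((x \<circ> \<pi>) i / (x \<circ> \<pi>) j) \<cdot>\<^sub>v u" if ij: "same_kind i j" for i j
  proof -
    have k: "same_kind (\<pi> i) (\<pi> j)" using same_kind_perm[OF \<pi> ij] .
    have "g \<circ> twist_pair i j = twist_pair (\<pi> i) (\<pi> j) \<circ> g"
      by (rule twist_pair_conj[OF g(1) permutes_inj[OF p] g(2)])
    then have c: "twist_pair i j \<circ> h = h \<circ> twist_pair (\<pi> i) (\<pi> j)"
      using h(2,3) by (metis comp_id id_comp o_assoc)
    have "\<rho> (twist_pair i j) *\<^sub>v u = (\<rho> (twist_pair i j) * \<rho> h) *\<^sub>v v"
      unfolding u_def by (rule assoc_mult_mat_vec[symmetric, OF car car]) (use twist_pair_G3[OF ij] h(1) v in auto)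
    also have "\<dots> = (\<rho> h * \<rho> (twist_pair (\<pi> i) (\<pi> j))) *\<^sub>v v"
      using hom twist_pair_G3[OF ij] twist_pair_G3[OF k] h(1) c by metis
    also have "\<dots> = \<rho> h *\<^sub>v ((x (\<pi> i) / x (\<pi> j)) \<cdot>\<^sub>v v)"
      using assoc_mult_mat_vec[OF car[OF h(1)] car[OF twist_pair_G3[OF k]] v(1)] eig[OF k] by simp
    also have "\<dots> = (x (\<pi> i) / x (\<pi> j)) \<cdot>\<^sub>v u"
      unfolding u_def using mult_mat_vec[OF car[OF h(1)] v(1)] by simp
    finally show ?thesis by simp
  qed
  moreover have "(x \<circ> \<pi>) i ^ 3 = 1" if "i < 8" for i
    using x cubie_perms_kind[OF \<pi>, of i] that by (simp add: is_weight_def)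
  moreover have "(x \<circ> \<pi>) i ^ 2 = 1" if "i \<in> {8..<20}" for i
    using x cubie_perms_kind[OF \<pi>, of i] that by (simp add: is_weight_def)
  ultimately show ?thesis using u unfolding is_weight_def by blast
qed

definition cj :: "bool \<Rightarrow> complex \<Rightarrow> complex" where
  "cj c z = (if c then cnj z else z)"

lemma omega_eq: "cis (2 * pi / 3) = Complex (- 1 / 2) (sqrt 3 / 2)"
  by (simp add: complex_eq_iff cos_120 sin_120)

lemma omega_equation: "cis (2 * pi / 3) * cis (2 * pi / 3) + cis (2 * pi / 3) + 1 = 0"
  by (simp only: omega_eq complex_eq_iff) simp

text \<open>The root 1 heads the list and is absent from the rest, the form needed to extract an
  eigenvalue different from 1.\<close>

lemma twist_pair_killed:
  assumes rep: "is_rep G3 n \<rho>" and ij: "same_kind i j"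
  shows "\<exists>zs. (\<forall>v\<in>carrier_vec n. killed_by (\<rho> (twist_pair i j)) (1 # zs) v) \<and> 1 \<notin> set (zs :: complex list)"
proof -
  have A: "\<rho> (twist_pair i j) \<in> carrier_mat n n" using rep twist_pair_G3[OF ij] by (simp add: is_rep_def)
  have hom: "\<rho> (f \<circ> f') = \<rho> f * \<rho> f'" if "f \<in> G3" "f' \<in> G3" for f f'
    using rep that by (simp add: is_rep_def)
  note t = twist_pair_G3[OF ij]
  show ?thesis
  proof (cases "i < 8 \<and> j < 8")
    case True
    have "\<rho> (twist_pair i j) * \<rho> (twist_pair i j) * \<rho> (twist_pair i j) = 1\<^sub>m n"
      using twist_pair_corner_order[of i j] True hom[OF t t] hom[OF G3_comp[OF t t] t] rep_id[OF rep G3_id] by simp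
    then have "\<forall>v\<in>carrier_vec n. killed_by (\<rho> (twist_pair i j))
        [1, cis (2 * pi / 3), cis (2 * pi / 3) * cis (2 * pi / 3)] v"
      using killed_by_order_3[OF A _ _ omega_equation] by blast
    moreover have "cis (2 * pi / 3) \<noteq> 1" "cis (2 * pi / 3) * cis (2 * pi / 3) \<noteq> 1"
      using omega_equation by (auto simp: omega_eq complex_eq_iff)
    ultimately show ?thesis by (intro exI[of _ "[cis (2 * pi / 3), cis (2 * pi / 3) * cis (2 * pi / 3)]"]) auto
  next
    case False
    then have "8 \<le> i" "8 \<le> j" using ij by (auto simp: same_kind_def)
    then have "\<rho> (twist_pair i j) * \<rho> (twist_pair i j) = 1\<^sub>m n"
      using twist_pair_edge_order[of i j] hom[OF t t] rep_id[OF rep G3_id] by simp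
    then show ?thesis using killed_by_order_2[OF A] by (intro exI[of _ "[-1]"]) auto
  qed
qed

text \<open>Faithfulness gives \<open>twist_pair a b\<close> an eigenvalue other than 1. A joint
  eigenvector retaining that eigenvalue has \<open>x a / x b\<close> equal to it.\<close>

lemma weight_exists:
  assumes rho: "faithful_rep G3 n \<rho>" and ab: "same_kind a b" "a \<noteq> b"
  shows "\<exists>x. is_weight \<rho> n x \<and> x a \<noteq> x b"
proof -
  have rep: "is_rep G3 n \<rho>" and inj: "inj_on \<rho> G3" using rho by (auto simp: faithful_rep_def)
  have car: "\<rho> f \<in> carrier_mat n n" if "f \<in> G3" for f using rep that by (simp add: is_rep_def)
  have hom: "\<rho> (f \<circ> f') = \<rho> f * \<rho> f'" if "f \<in> G3" "f' \<in> G3" for f f'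
    using rep that by (simp add: is_rep_def)
  define A where "A = \<rho> (twist_pair a b)"
  note t = twist_pair_G3[OF ab(1)]
  have "twist_pair a b \<noteq> id"
  proof
    assume id: "twist_pair a b = id"
    have a: "a < 20" using ab by (auto simp: same_kind_def)
    then have "spin (home a) = home a"
      using home_props(2)[OF a] fun_cong[OF id, of "home a"] ab(2) by (simp add: twist_pair_def)
    moreover have "\<forall>z\<in>{1..48}. spin z \<noteq> z" by (simp only: all_stickers sticker_eval) simp
    ultimately show False using home_props(1)[OF a] by blast
  qed
  then have "A \<noteq> 1\<^sub>m n"
    using inj_onD[OF inj _ t G3_id] rep_id[OF rep G3_id] by (auto simp: A_def)
  obtain zs where zs: "\<And>v. v \<in> carrier_vec n \<Longrightarrow> killed_by A (1 # zs) v" "1 \<notin> set zs"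
    using twist_pair_killed[OF rep ab(1)] by (auto simp: A_def)
  obtain v \<zeta> where v: "v \<in> carrier_vec n" "v \<noteq> 0\<^sub>v n" "A *\<^sub>v v = \<zeta> \<cdot>\<^sub>v v" and \<zeta>: "\<zeta> \<noteq> 1"
    using killed_by_eigenvector_nontrivial[OF _ \<open>A \<noteq> 1\<^sub>m n\<close> zs(1)] car[OF t] zs(2) by (auto simp: A_def)
  define P where "P = {(i, j). same_kind i j}"
  define \<A> where "\<A> = (\<lambda>(i, j). \<rho> (twist_pair i j)) ` P"
  have "P \<subseteq> {..<20} \<times> {..<20}" by (auto simp: P_def same_kind_def)
  then have fin: "finite \<A>" unfolding \<A>_def by (intro finite_imageI) (rule finite_subset, auto)
  have comm: "\<rho> (twist_pair i j) * \<rho> (twist_pair k l) = \<rho> (twist_pair k l) * \<rho> (twist_pair i j)"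
    if "same_kind i j" "same_kind k l" for i j k l
    using hom twist_pair_G3 that twist_pair_commute by metis
  have "\<exists>w\<in>carrier_vec n. w \<noteq> 0\<^sub>v n \<and> (\<forall>A\<in>\<A>. \<exists>\<zeta>. A *\<^sub>v w = \<zeta> \<cdot>\<^sub>v w) \<and>
    (\<forall>B\<in>carrier_mat n n. \<forall>\<mu>. (\<forall>A\<in>\<A>. A * B = B * A) \<longrightarrow> B *\<^sub>v v = \<mu> \<cdot>\<^sub>v v \<longrightarrow> B *\<^sub>v w = \<mu> \<cdot>\<^sub>v w)"
  proof (rule joint_eigenvector[OF fin _ _ _ v(1,2)])
    show "\<A> \<subseteq> carrier_mat n n" using car twist_pair_G3 by (auto simp: \<A>_def P_def)
    show "A * B = B * A" if "A \<in> \<A>" "B \<in> \<A>" for A B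
      using that comm by (auto simp: \<A>_def P_def)
    show "\<exists>zs. \<forall>v\<in>carrier_vec n. killed_by A zs v" if "A \<in> \<A>" for A
      using that twist_pair_killed[OF rep] unfolding \<A>_def P_def by fast
  qed
  then obtain w where w: "w \<in> carrier_vec n" "w \<noteq> 0\<^sub>v n"
    and eig: "\<And>i j. same_kind i j \<Longrightarrow> \<exists>\<zeta>. \<rho> (twist_pair i j) *\<^sub>v w = \<zeta> \<cdot>\<^sub>v w"
    and Bw: "\<And>B \<mu>. B \<in> carrier_mat n n \<Longrightarrow> (\<forall>A\<in>\<A>. A * B = B * A) \<Longrightarrow> B *\<^sub>v v = \<mu> \<cdot>\<^sub>v v \<Longrightarrow> B *\<^sub>v w = \<mu> \<cdot>\<^sub>v w"
    by (auto simp: \<A>_def P_def)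
  have Aw: "A *\<^sub>v w = \<zeta> \<cdot>\<^sub>v w"
    using v(3) car[OF t] comm[OF _ ab(1)] by (intro Bw) (auto simp: \<A>_def P_def A_def)
  obtain c where c: "\<And>i j. same_kind i j \<Longrightarrow> \<rho> (twist_pair i j) *\<^sub>v w = c i j \<cdot>\<^sub>v w" using eig by metis
  have scalar_eq: "s = r" if "s \<cdot>\<^sub>v w = r \<cdot>\<^sub>v w" for s r
  proof -
    obtain k where k: "k < n" "w $ k \<noteq> 0" using w by (metis carrier_vecD eq_vecI index_zero_vec)
    then show ?thesis using arg_cong[OF that, of "\<lambda>u. u $ k"] w(1) by simp
  qed
  have c_comp: "c i j * c j k = c i k" if "same_kind i j" "same_kind j k" for i j k
  proof (rule scalar_eq)
    have ik: "same_kind i k" using that by (auto simp: same_kind_def)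
    have "c i k \<cdot>\<^sub>v w = (\<rho> (twist_pair i j) * \<rho> (twist_pair j k)) *\<^sub>v w"
      using c[OF ik] hom twist_pair_G3 that twist_pair_comp by metis
    also have "\<dots> = \<rho> (twist_pair i j) *\<^sub>v (c j k \<cdot>\<^sub>v w)"
      using assoc_mult_mat_vec[OF car car w(1)] twist_pair_G3 that c[OF that(2)] by simp
    also have "\<dots> = c j k \<cdot>\<^sub>v (c i j \<cdot>\<^sub>v w)"
      using mult_mat_vec[OF car[OF twist_pair_G3[OF that(1)]] w(1)] c[OF that(1)] by simp
    also have "\<dots> = (c i j * c j k) \<cdot>\<^sub>v w" by (simp add: smult_smult_assoc mult.commute)
    finally show "(c i j * c j k) \<cdot>\<^sub>v w = c i k \<cdot>\<^sub>v w" by simp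
  qed
  have c_same: "c i i = 1" if "same_kind i i" for i
  proof (rule scalar_eq)
    show "c i i \<cdot>\<^sub>v w = 1 \<cdot>\<^sub>v w"
      using c[OF that] w rep_id[OF rep G3_id] by (simp add: twist_pair_same)
  qed
  \<comment> \<open>One base cubie for each kind: the cocycle \<open>c\<close> becomes a ratio after
    fixing its second argument at the base.\<close>
  define r where "r i = (if i < 8 then 0 else 8 :: nat)" for i :: nat
  define x where "x i = c i (r i)" for i
  have ratio: "c i j = x i / x j" if ij: "same_kind i j" for i j
  proof -
    have o: "same_kind i (r i)" "same_kind (r i) j" "same_kind j (r i)" "r j = r i" "same_kind j j"
      using ij by (auto simp: same_kind_def r_def)
    have "c i (r i) * c (r i) j = c i j" "c j (r i) * c (r i) j = 1"
      using c_comp o c_same by auto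
    then show ?thesis by (simp add: x_def o(4) field_simps) (metis mult.left_commute mult_cancel_left mult_zero_left mult.right_neutral nonzero_eq_divide_eq)
  qed
  have w_x: "is_weight \<rho> n x"
    unfolding is_weight_def
  proof (intro conjI allI impI ballI bexI[of _ w])
    show "\<rho> (twist_pair i j) *\<^sub>v w = (x i / x j) \<cdot>\<^sub>v w" if "same_kind i j" for i j
      using c ratio that by simp
    show "x i ^ 3 = 1" if i: "i < 8" for i
    proof (rule scalar_eq)
      have k: "same_kind i (r i)" using i by (auto simp: same_kind_def r_def)
      let ?A = "\<rho> (twist_pair i (r i))"
      have A: "?A \<in> carrier_mat n n" using car twist_pair_G3[OF k] by simp
      have sm: "?A *\<^sub>v (s \<cdot>\<^sub>v w) = (s * x i) \<cdot>\<^sub>v w" for s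
        using mult_mat_vec[OF A w(1)] c[OF k] by (simp add: x_def smult_smult_assoc)
      have "?A * ?A * ?A = 1\<^sub>m n"
        using twist_pair_corner_order[of i "r i"] i hom twist_pair_G3[OF k] G3_comp rep_id[OF rep G3_id]
        by (metis r_def zero_less_numeral)
      then have "w = ?A *\<^sub>v (?A *\<^sub>v (?A *\<^sub>v (1 \<cdot>\<^sub>v w)))"
        using assoc_mult_mat_vec[of "?A * ?A" n n ?A n w] assoc_mult_mat_vec[of ?A n n ?A n "?A *\<^sub>v w"] A w(1) by simp
      then show "x i ^ 3 \<cdot>\<^sub>v w = 1 \<cdot>\<^sub>v w" unfolding sm by (simp add: power3_eq_cube)
    qed
    show "x i ^ 2 = 1" if i: "i \<in> {8..<20}" for i
    proof (rule scalar_eq)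
      have k: "same_kind i (r i)" using i by (auto simp: same_kind_def r_def)
      let ?A = "\<rho> (twist_pair i (r i))"
      have A: "?A \<in> carrier_mat n n" using car twist_pair_G3[OF k] by simp
      have sm: "?A *\<^sub>v (s \<cdot>\<^sub>v w) = (s * x i) \<cdot>\<^sub>v w" for s
        using mult_mat_vec[OF A w(1)] c[OF k] by (simp add: x_def smult_smult_assoc)
      have "?A * ?A = 1\<^sub>m n"
        using twist_pair_edge_order[of i "r i"] i hom[OF twist_pair_G3[OF k] twist_pair_G3[OF k]] rep_id[OF rep G3_id]
        by (simp add: r_def)
      then have "w = ?A *\<^sub>v (?A *\<^sub>v (1 \<cdot>\<^sub>v w))"
        using assoc_mult_mat_vec[of ?A n n ?A n w] A w(1) by simp
      then show "x i ^ 2 \<cdot>\<^sub>v w = 1 \<cdot>\<^sub>v w" unfolding sm by (simp add: power2_eq_square)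
    qed
  qed (use w in auto)
  moreover have "x a / x b = \<zeta>" using scalar_eq Aw c[OF ab(1)] ratio[OF ab(1)] by (simp add: A_def)
  then have "x a \<noteq> x b" using \<zeta> is_weight_nonzero[OF w_x, of b] ab(1) by (auto simp: same_kind_def)
  ultimately show ?thesis by blast
qed

lemma weights_card_le:
  assumes rep: "is_rep G3 n \<rho>" and "finite I" and wt: "\<And>i. i \<in> I \<Longrightarrow> is_weight \<rho> n (\<xi> i)"
    and sep: "\<And>i j. i \<in> I \<Longrightarrow> j \<in> I \<Longrightarrow> i \<noteq> j \<Longrightarrow> \<exists>a b. same_kind a b \<and> \<xi> i a / \<xi> i b \<noteq> \<xi> j a / \<xi> j b"
  shows "card I \<le> n"
proof -
  have "\<forall>i\<in>I. \<exists>v. v \<in> carrier_vec n \<and> v \<noteq> 0\<^sub>v n \<and>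
      (\<forall>a b. same_kind a b \<longrightarrow> \<rho> (twist_pair a b) *\<^sub>v v = (\<xi> i a / \<xi> i b) \<cdot>\<^sub>v v)"
    using wt unfolding is_weight_def by blast
  then obtain v where v: "\<And>i. i \<in> I \<Longrightarrow> v i \<in> carrier_vec n \<and> v i \<noteq> 0\<^sub>v n"
    and eig: "\<And>i a b. i \<in> I \<Longrightarrow> same_kind a b \<Longrightarrow> \<rho> (twist_pair a b) *\<^sub>v v i = (\<xi> i a / \<xi> i b) \<cdot>\<^sub>v v i"
    by metis
  show ?thesis
  proof (rule distinct_weights_card_le[OF \<open>finite I\<close> _ v])
    let ?L = "{(a, b). same_kind a b}" and ?M = "\<lambda>(a, b). \<rho> (twist_pair a b)"
      and ?\<chi> = "\<lambda>i (a, b). \<xi> i a / \<xi> i b"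
    show "?M l \<in> carrier_mat n n" if "l \<in> ?L" for l
      using that rep twist_pair_G3 by (auto simp: is_rep_def)
    show "?M l *\<^sub>v v i = ?\<chi> i l \<cdot>\<^sub>v v i" if "i \<in> I" "l \<in> ?L" for i l
      using that eig by auto
    show "\<exists>l\<in>?L. ?\<chi> i l \<noteq> ?\<chi> j l" if "i \<in> I" "j \<in> I" "i \<noteq> j" for i j
      using sep[OF that] by auto
  qed
qed

section \<open>Counting the conjugates of a weight\<close>

lemma card_roots_bound: "finite {z :: complex. z ^ 3 = 1}" "card {z :: complex. z ^ 3 = 1} \<le> 3"
  "finite {z :: complex. z ^ 2 = 1}" "card {z :: complex. z ^ 2 = 1} \<le> 2"
  using finite_roots_unity[of 3, where 'a = complex] card_roots_unity[of 3, where 'a = complex]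
    finite_roots_unity[of 2, where 'a = complex] card_roots_unity[of 2, where 'a = complex] by simp_all

lemma is_weight_values:
  "is_weight \<rho> n x \<Longrightarrow> x ` {..<8} \<subseteq> {z. z ^ 3 = 1}"
  "is_weight \<rho> n x \<Longrightarrow> x ` {8..<20} \<subseteq> {z. z ^ 2 = 1}"
  by (auto simp: is_weight_def)

lemma repeated_value:
  assumes "finite Z" "x ` D \<subseteq> Z" "card Z < card D"
  shows "\<exists>i\<in>D. \<exists>j\<in>D. i \<noteq> j \<and> x i = x j"
proof -
  have "card (x ` D) < card D" using card_mono[OF assms(1,2)] assms(3) by simp
  then show ?thesis using pigeonhole[of x D] unfolding inj_on_def by blast
qed

text \<open>At most three values on eight corners force a repetition, so odd permutations are
  covered too.\<close>

lemma is_weight_corner_perm: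
  assumes rep: "is_rep G3 n \<rho>" and x: "is_weight \<rho> n x" and \<pi>: "\<pi> permutes {..<8}"
  shows "is_weight \<rho> n (x \<circ> \<pi>)"
proof -
  obtain i j where "i \<in> {..<8}" "j \<in> {..<8}" "i \<noteq> j" "x i = x j"
    using repeated_value[OF card_roots_bound(1) is_weight_values(1)[OF x]] card_roots_bound(2) by auto
  then have "\<exists>\<pi>'\<in>cubie_perms. x \<circ> \<pi> = x \<circ> \<pi>'"
    using \<pi> corner_cycles
    by (intro rearrangement_by_even[of "{..<8}" 0 1 cubie_perms i j x \<pi>, OF _ _ _ _ cubie_perms_id cubie_perms_comp
        cubie_perms_inverse]) simp_all
  then show ?thesis using is_weight_perm[OF rep x] by auto
qed

lemma is_weight_edge_perm:
  assumes rep: "is_rep G3 n \<rho>" and x: "is_weight \<rho> n x" and \<pi>: "\<pi> permutes {8..<20}"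
  shows "is_weight \<rho> n (x \<circ> \<pi>)"
proof -
  obtain i j where "i \<in> {8..<20}" "j \<in> {8..<20}" "i \<noteq> j" "x i = x j"
    using repeated_value[OF card_roots_bound(3) is_weight_values(2)[OF x]] card_roots_bound(4) by auto
  then have "\<exists>\<pi>'\<in>cubie_perms. x \<circ> \<pi> = x \<circ> \<pi>'"
    using \<pi> edge_cycles
    by (intro rearrangement_by_even[of "{8..<20}" 8 9 cubie_perms i j x \<pi>, OF _ _ _ _ cubie_perms_id cubie_perms_comp
        cubie_perms_inverse]) simp_all
  then show ?thesis using is_weight_perm[OF rep x] by auto
qed

lemma real_cube_root_unity:
  fixes z :: complex
  assumes "z ^ 3 = 1" "cnj z = z" shows "z = 1"
proof -
  have z: "z = of_real (Re z)" using assms(2) by (simp add: complex_eq_iff)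
  then have "of_real (Re z ^ 3) = (1 :: complex)" using assms(1) by (metis of_real_power)
  then have "Re z ^ 3 = 1" using of_real_eq_1_iff by blast
  then have "Re z = 1"
    using power_eq_imp_eq_base[of "Re z" 3 1] zero_less_power_eq[of "Re z" 3] by auto
  then show ?thesis using z by simp
qed

text \<open>Equality of all ratios is normalized at a point where both rearrangements take the
  majority value \<open>c\<close>; then the exceptional sets \<open>T\<close> can be read off. The
  last conclusion includes \<open>T = T'\<close>: a rearranged weight is not even its own
  conjugate.\<close>

lemma projectively_distinct_rearrangements:
  fixes x :: "nat \<Rightarrow> complex"
  assumes D: "finite D" and Z: "finite Z" "x ` D \<subseteq> Z" "card Z * k < card D" "0 \<notin> Z"
    and k: "2 \<le> k" "card D \<le> (k + 3) choose 2" and nonconst: "i \<in> D" "j \<in> D" "x i \<noteq> x j"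
  obtains \<T> :: "nat set set" and p where "finite \<T>" "card D \<le> card \<T>" "\<forall>T\<in>\<T>. p T permutes D"
    "\<forall>T\<in>\<T>. \<exists>a\<in>D. \<exists>b\<in>D. x (p T a) / x (p T b) \<noteq> 1"
    "\<forall>T\<in>\<T>. \<forall>T'\<in>\<T>. T \<noteq> T' \<longrightarrow>
      (\<exists>a\<in>D. \<exists>b\<in>D. x (p T a) / x (p T b) \<noteq> x (p T' a) / x (p T' b))"
    "Z \<subseteq> {z. z ^ 3 = 1} \<longrightarrow> (\<forall>T\<in>\<T>. \<forall>T'\<in>\<T>.
      \<exists>a\<in>D. \<exists>b\<in>D. x (p T a) / x (p T b) \<noteq> cnj (x (p T' a) / x (p T' b)))"
proof -
  obtain c W \<T> p where c: "c \<in> x ` D" and W: "W \<subseteq> D" and \<T>: "finite \<T>" "card D \<le> card \<T>"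
    and obj: "\<forall>T\<in>\<T>. T \<subseteq> W \<and> T \<noteq> {} \<and> 2 * card T < card W" "\<forall>T\<in>\<T>. p T permutes D"
      "\<forall>T\<in>\<T>. \<forall>w\<in>W. x (p T w) = c \<longleftrightarrow> w \<notin> T"
    by (rule many_rearrangements[OF D Z(1-3) k nonconst])
  note T = obj(1)[rule_format] and p = obj(2)[rule_format] and val = obj(3)[rule_format]
  have c0: "c \<noteq> 0" using c Z by auto
  have finW: "finite W" using finite_subset[OF W D] .
  have common: "\<exists>w\<in>W. w \<notin> T \<and> w \<notin> T'" if "T \<in> \<T>" "T' \<in> \<T>" for T T'
    using common_majority_point[OF finW] T that by simp
  have 1: "\<exists>a\<in>D. \<exists>b\<in>D. x (p T a) / x (p T b) \<noteq> 1" if tT: "T \<in> \<T>" for T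
  proof -
    obtain w where w: "w \<in> W" "w \<notin> T" using common[OF tT tT] by blast
    obtain t where t: "t \<in> T" "t \<in> W" using T[OF tT] by blast
    have "x (p T w) = c" "x (p T t) \<noteq> c" using val[OF tT] w t by auto
    then have "x (p T t) / x (p T w) \<noteq> 1" using c0 by simp
    then show ?thesis using W w t by blast
  qed
  have 2: "T = T'" if TT: "T \<in> \<T>" "T' \<in> \<T>"
    and eq: "\<forall>a\<in>D. \<forall>b\<in>D. x (p T a) / x (p T b) = x (p T' a) / x (p T' b)" for T T'
  proof -
    obtain w where w: "w \<in> W" "w \<notin> T" "w \<notin> T'" using common[OF TT] by blast
    have same: "x (p T a) = x (p T' a)" if "a \<in> W" for a
    proof -
      have "x (p T a) / c = x (p T' a) / c" 
        using bspec[OF bspec[OF eq], of a w] val[OF TT(1) w(1)] val[OF TT(2) w(1)] w W that by auto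
      then show ?thesis using c0 by simp
    qed
    have "a \<in> T \<longleftrightarrow> a \<in> T'" if "a \<in> W" for a
      using same[OF that] val[OF TT(1) that] val[OF TT(2) that] by simp
    then show ?thesis using T TT by blast
  qed
  have 3: False if TT: "T \<in> \<T>" "T' \<in> \<T>" and cube: "Z \<subseteq> {z. z ^ 3 = 1}"
    and eq: "\<forall>a\<in>D. \<forall>b\<in>D. x (p T a) / x (p T b) = cnj (x (p T' a) / x (p T' b))" for T T'
  proof -
    obtain w where w: "w \<in> W" "w \<notin> T" "w \<notin> T'" using common[OF TT] by blast
    have ratio: "x (p T a) / c = cnj (x (p T' a) / c)" if "a \<in> W" for a
      using bspec[OF bspec[OF eq], of a w] val[OF TT(1) w(1)] val[OF TT(2) w(1)] w W that by auto
    have same: "x (p T a) = c \<longleftrightarrow> x (p T' a) = c" if "a \<in> W" for a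
    proof -
      have "x (p T a) = c \<longleftrightarrow> x (p T a) / c = 1" "x (p T' a) = c \<longleftrightarrow> x (p T' a) / c = 1" using c0 by auto
      moreover have "x (p T a) / c = 1 \<longleftrightarrow> x (p T' a) / c = 1" unfolding ratio[OF that] by (rule complex_cnj_one_iff)
      ultimately show ?thesis by blast
    qed
    have "a \<in> T \<longleftrightarrow> a \<in> T'" if "a \<in> W" for a
      using same[OF that] val[OF TT(1) that] val[OF TT(2) that] by simp
    then have TT': "T = T'" using T TT by blast
    \<comment> \<open>At an exceptional place the ratio to \<open>c\<close> would be a cube root of
      unity fixed by conjugation, hence 1, yet the value there differs from
      \<open>c\<close>.\<close>
    obtain t where t: "t \<in> T" "t \<in> W" using T[OF TT(1)] by blast
    have "p T t \<in> D" using t W permutes_in_image[OF p[OF TT(1)]] by blast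
    then have "x (p T t) ^ 3 = 1" "c ^ 3 = 1" using Z(2) cube c by auto
    then have "(x (p T t) / c) ^ 3 = 1" by (simp add: power_divide)
    moreover have "cnj (x (p T t) / c) = x (p T t) / c" using ratio[OF t(2)] TT' by metis
    ultimately have "x (p T t) / c = 1" by (rule real_cube_root_unity)
    then show False using val[OF TT(1) t(2)] t(1) c0 by simp
  qed
  show thesis by (rule that[OF \<T>, of p]) (use p 1 2 3 in blast)+
qed

lemma cj_simps: "cj c (z / w) = cj c z / cj c w" "cj c 1 = 1" "cj c z = cj c w \<longleftrightarrow> z = w"
  by (auto simp: cj_def)

text \<open>Here \<open>k = 2\<close>: three values on 8 corners repeat one more than twice, and
  \<open>5 choose 2 = 10\<close> covers 8.\<close>

lemma corner_rearrangements:
  assumes x: "is_weight \<rho> n x" "i < 8" "j < 8" "x i \<noteq> x j"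
  obtains \<T> :: "nat set set" and p where "finite \<T>" "8 \<le> card \<T>" "\<forall>T\<in>\<T>. p T permutes {..<8}"
    "\<forall>T\<in>\<T>. \<exists>a<8. \<exists>b<8. x (p T a) / x (p T b) \<noteq> 1"
    "\<forall>T\<in>\<T>. \<forall>T'\<in>\<T>. T \<noteq> T' \<longrightarrow> (\<exists>a<8. \<exists>b<8. x (p T a) / x (p T b) \<noteq> x (p T' a) / x (p T' b))"
    "\<forall>T\<in>\<T>. \<forall>T'\<in>\<T>. \<exists>a<8. \<exists>b<8. x (p T a) / x (p T b) \<noteq> cnj (x (p T' a) / x (p T' b))"
proof (rule projectively_distinct_rearrangements[OF finite_lessThan card_roots_bound(1) is_weight_values(1)[OF x(1)], of 2 i j])
  show "card {z :: complex. z ^ 3 = 1} * 2 < card {..<8 :: nat}" "card {..<8 :: nat} \<le> (2 + 3) choose 2"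
    using card_roots_bound(2) by (simp_all add: choose_two)
  fix \<T> :: "nat set set" and p
  assume "finite \<T>" "card {..<8 :: nat} \<le> card \<T>" "\<forall>T\<in>\<T>. p T permutes {..<8}"
    "\<forall>T\<in>\<T>. \<exists>a\<in>{..<8}. \<exists>b\<in>{..<8}. x (p T a) / x (p T b) \<noteq> 1"
    "\<forall>T\<in>\<T>. \<forall>T'\<in>\<T>. T \<noteq> T' \<longrightarrow>
      (\<exists>a\<in>{..<8}. \<exists>b\<in>{..<8}. x (p T a) / x (p T b) \<noteq> x (p T' a) / x (p T' b))"
    "{z. z ^ 3 = 1} \<subseteq> {z :: complex. z ^ 3 = 1} \<longrightarrow> (\<forall>T\<in>\<T>. \<forall>T'\<in>\<T>.
      \<exists>a\<in>{..<8}. \<exists>b\<in>{..<8}. x (p T a) / x (p T b) \<noteq> cnj (x (p T' a) / x (p T' b)))"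
  then show thesis by (intro that[of \<T> p]) (simp_all only: Bex_def lessThan_iff card_lessThan subset_refl simp_thms)
qed (use x in simp_all)

text \<open>Here \<open>k = 3\<close>: two values on 12 edges repeat one more than three times, and
  \<open>6 choose 2 = 15\<close> covers 12.\<close>

lemma edge_rearrangements:
  assumes x: "is_weight \<rho> n x" "i \<in> {8..<20}" "j \<in> {8..<20}" "x i \<noteq> x j"
  obtains \<T> :: "nat set set" and p where "finite \<T>" "12 \<le> card \<T>" "\<forall>T\<in>\<T>. p T permutes {8..<20}"
    "\<forall>T\<in>\<T>. \<forall>T'\<in>\<T>. T \<noteq> T' \<longrightarrow>
      (\<exists>a\<in>{8..<20}. \<exists>b\<in>{8..<20}. x (p T a) / x (p T b) \<noteq> x (p T' a) / x (p T' b))"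
proof (rule projectively_distinct_rearrangements[OF finite_atLeastLessThan card_roots_bound(3)
      is_weight_values(2)[OF x(1)], of 3 i j])
  show "card {z :: complex. z ^ 2 = 1} * 3 < card {8..<20 :: nat}" "card {8..<20 :: nat} \<le> (3 + 3) choose 2"
    using card_roots_bound(4) by (simp_all add: choose_two)
  fix \<T> :: "nat set set" and p
  assume "finite \<T>" "card {8..<20 :: nat} \<le> card \<T>" "\<forall>T\<in>\<T>. p T permutes {8..<20}"
    "\<forall>T\<in>\<T>. \<forall>T'\<in>\<T>. T \<noteq> T' \<longrightarrow>
      (\<exists>a\<in>{8..<20}. \<exists>b\<in>{8..<20}. x (p T a) / x (p T b) \<noteq> x (p T' a) / x (p T' b))"
  then show thesis by (intro that[of \<T> p]) simp_all
qed (use x in simp_all)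

text \<open>\<open>C\<close> lists the conjugations that preserve weights: \<open>{False}\<close> in
  general, both booleans for a representation defined over the reals. This yields 20 and 28 from one
  count.\<close>

lemma dimension_lower_bound:
  assumes rho: "faithful_rep G3 n \<rho>"
    and C: "C \<noteq> {}" "\<And>c x. c \<in> C \<Longrightarrow> is_weight \<rho> n x \<Longrightarrow> is_weight \<rho> n (cj c \<circ> x)"
  shows "8 * card C + 12 \<le> n"
proof -
  have rep: "is_rep G3 n \<rho>" using rho by (simp add: faithful_rep_def)
  have C2: "card C \<le> 2" using card_mono[of "UNIV :: bool set" C] by simp
  show ?thesis
  proof (cases "\<exists>x i j i' j'. is_weight \<rho> n x \<and> i < 8 \<and> j < 8 \<and> x i \<noteq> x j \<and>
      i' \<in> {8..<20} \<and> j' \<in> {8..<20} \<and> x i' \<noteq> x j'")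
    case True
    then obtain x i j i' j' where x: "is_weight \<rho> n x"
      and ij: "i < 8" "j < 8" "x i \<noteq> x j" "i' \<in> {8..<20}" "j' \<in> {8..<20}" "x i' \<noteq> x j'" by blast
    obtain \<T> :: "nat set set" and p where \<T>: "finite \<T>" "8 \<le> card \<T>" "\<forall>T\<in>\<T>. p T permutes {..<8}"
      and "\<forall>T\<in>\<T>. \<exists>a<8. \<exists>b<8. x (p T a) / x (p T b) \<noteq> 1"
      and sep0: "\<forall>T\<in>\<T>. \<forall>T'\<in>\<T>. T \<noteq> T' \<longrightarrow> (\<exists>a<8. \<exists>b<8. x (p T a) / x (p T b) \<noteq> x (p T' a) / x (p T' b))"
      and "\<forall>T\<in>\<T>. \<forall>T'\<in>\<T>. \<exists>a<8. \<exists>b<8. x (p T a) / x (p T b) \<noteq> cnj (x (p T' a) / x (p T' b))"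
      by (rule corner_rearrangements[OF x ij(1-3)])
    obtain \<S> :: "nat set set" and q where \<S>: "finite \<S>" "12 \<le> card \<S>" "\<forall>T\<in>\<S>. q T permutes {8..<20}"
      and sep0': "\<forall>T\<in>\<S>. \<forall>T'\<in>\<S>. T \<noteq> T' \<longrightarrow>
        (\<exists>a\<in>{8..<20}. \<exists>b\<in>{8..<20}. x (q T a) / x (q T b) \<noteq> x (q T' a) / x (q T' b))"
      by (rule edge_rearrangements[OF x ij(4-6)])
    note sep = sep0[rule_format] and sep' = sep0'[rule_format] and p = \<T>(3)[rule_format] and q = \<S>(3)[rule_format]
    \<comment> \<open>A mixed weight is rearranged independently on corners and edges, so the two
      counts multiply.\<close>
    define \<xi> where "\<xi> = (\<lambda>(T, S). x \<circ> p T \<circ> q S)"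
    have on_corner: "\<xi> (T, S) a = x (p T a)" if "S \<in> \<S>" "a < 8" for T S a
      using permutes_not_in[OF q[OF that(1)], of a] that(2) by (simp add: \<xi>_def)
    have on_edge: "\<xi> (T, S) a = x (q S a)" if "T \<in> \<T>" "S \<in> \<S>" "a \<in> {8..<20}" for T S a
    proof -
      have "q S a \<in> {8..<20}" using permutes_in_image[OF q[OF that(2)], of a] that(3) by simp
      then show ?thesis using permutes_not_in[OF p[OF that(1)], of "q S a"] by (simp add: \<xi>_def)
    qed
    have "card (\<T> \<times> \<S>) \<le> n"
    proof (rule weights_card_le[OF rep, where \<xi> = \<xi>])
      show "finite (\<T> \<times> \<S>)" using \<T> \<S> by simp
      show "is_weight \<rho> n (\<xi> t)" if "t \<in> \<T> \<times> \<S>" for t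
        using that p q is_weight_edge_perm[OF rep is_weight_corner_perm[OF rep x]] by (auto simp: \<xi>_def)
      show "\<exists>a b. same_kind a b \<and> \<xi> t a / \<xi> t b \<noteq> \<xi> t' a / \<xi> t' b"
        if t: "t \<in> \<T> \<times> \<S>" "t' \<in> \<T> \<times> \<S>" "t \<noteq> t'" for t t'
      proof -
        obtain T S T' S' where tt: "t = (T, S)" "t' = (T', S')" "T \<in> \<T>" "S \<in> \<S>" "T' \<in> \<T>" "S' \<in> \<S>"
          using t by auto
        show ?thesis
        proof (cases "T = T'")
          case True
          then obtain a b where "a \<in> {8..<20}" "b \<in> {8..<20}" "x (q S a) / x (q S b) \<noteq> x (q S' a) / x (q S' b)"
            using sep'[of S S'] tt t(3) by blast
          then show ?thesis using tt on_edge by (intro exI[of _ a] exI[of _ b]) (simp add: same_kind_def)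
        next
          case False
          then obtain a b where "a < 8" "b < 8" "x (p T a) / x (p T b) \<noteq> x (p T' a) / x (p T' b)"
            using sep[of T T'] tt by blast
          then show ?thesis using tt on_corner by (intro exI[of _ a] exI[of _ b]) (simp add: same_kind_def)
        qed
      qed
    qed
    moreover have "8 * 12 \<le> card \<T> * card \<S>" using \<T>(2) \<S>(2) by (rule mult_le_mono)
    ultimately show ?thesis using C2 by (simp add: card_cartesian_product)
  next
    case False
    then have dich: "x i' = x j'" if "is_weight \<rho> n x" "i < 8" "j < 8" "x i \<noteq> x j" "i' \<in> {8..<20}" "j' \<in> {8..<20}"
      for x i j i' j' using that by blast
    obtain x where x: "is_weight \<rho> n x" "x 0 \<noteq> x 1"
      using weight_exists[OF rho, of 0 1] by (auto simp: same_kind_def)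
    obtain y where y: "is_weight \<rho> n y" "y 8 \<noteq> y 9"
      using weight_exists[OF rho, of 8 9] by (auto simp: same_kind_def)
    \<comment> \<open>Without mixed weights, a weight that distinguishes edges is constant on
      corners; its corner ratios are 1, which separates its family from that of
      \<open>x\<close>.\<close>
    have y_const: "y a = y b" if "a < 8" "b < 8" for a b
      using dich[OF y(1) that _, of 8 9] y(2) by auto
    obtain \<T> :: "nat set set" and p where \<T>: "finite \<T>" "8 \<le> card \<T>" "\<forall>T\<in>\<T>. p T permutes {..<8}"
      and nt0: "\<forall>T\<in>\<T>. \<exists>a<8. \<exists>b<8. x (p T a) / x (p T b) \<noteq> 1"
      and sep0: "\<forall>T\<in>\<T>. \<forall>T'\<in>\<T>. T \<noteq> T' \<longrightarrow> (\<exists>a<8. \<exists>b<8. x (p T a) / x (p T b) \<noteq> x (p T' a) / x (p T' b))"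
      and csep0: "\<forall>T\<in>\<T>. \<forall>T'\<in>\<T>. \<exists>a<8. \<exists>b<8. x (p T a) / x (p T b) \<noteq> cnj (x (p T' a) / x (p T' b))"
      by (rule corner_rearrangements[OF x(1) _ _ x(2)], simp, simp)
    obtain \<S> :: "nat set set" and q where \<S>: "finite \<S>" "12 \<le> card \<S>" "\<forall>T\<in>\<S>. q T permutes {8..<20}"
      and sep0': "\<forall>T\<in>\<S>. \<forall>T'\<in>\<S>. T \<noteq> T' \<longrightarrow>
        (\<exists>a\<in>{8..<20}. \<exists>b\<in>{8..<20}. y (q T a) / y (q T b) \<noteq> y (q T' a) / y (q T' b))"
      by (rule edge_rearrangements[OF y(1) _ _ y(2)], simp, simp)
    note nt = nt0[rule_format] and sep = sep0[rule_format] and csep = csep0[rule_format] and sep' = sep0'[rule_format]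
      and p = \<T>(3)[rule_format] and q = \<S>(3)[rule_format]
    define \<xi> where "\<xi> t = (case t of Inl (T, c) \<Rightarrow> cj c \<circ> (x \<circ> p T) | Inr S \<Rightarrow> y \<circ> q S)" for t
    have xi: "\<xi> (Inl (T, c)) a / \<xi> (Inl (T, c)) b = cj c (x (p T a) / x (p T b))" "\<xi> (Inr S) a = y (q S a)"
      for T c a b S by (simp_all add: \<xi>_def cj_simps)
    have y1: "\<xi> (Inr S) a / \<xi> (Inr S) b = 1" if "S \<in> \<S>" "a < 8" "b < 8" for S a b
    proof -
      have "q S a = a" "q S b = b" using permutes_not_in[OF q[OF that(1)]] that by auto
      then show ?thesis using y_const[OF that(2,3)] is_weight_nonzero[OF y(1), of b] that(3) by (simp add: xi)
    qed
    have left_right: "\<exists>a b. same_kind a b \<and> \<xi> (Inl (T, c)) a / \<xi> (Inl (T, c)) b \<noteq> \<xi> (Inr S) a / \<xi> (Inr S) b"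
      if TS: "T \<in> \<T>" "S \<in> \<S>" for T c S
    proof -
      obtain a b where ab: "a < 8" "b < 8" "x (p T a) / x (p T b) \<noteq> 1" using nt[OF TS(1)] by blast
      then have "cj c (x (p T a) / x (p T b)) \<noteq> 1" using cj_simps(2,3) by metis
      then show ?thesis using ab y1[OF TS(2) ab(1,2)] unfolding xi(1) by (intro exI[of _ a] exI[of _ b]) (simp add: same_kind_def)
    qed
    have "card ((\<T> \<times> C) <+> \<S>) \<le> n"
    proof (rule weights_card_le[OF rep, where \<xi> = \<xi>])
      show "finite ((\<T> \<times> C) <+> \<S>)" using \<T> \<S> by simp
      show "is_weight \<rho> n (\<xi> t)" if "t \<in> (\<T> \<times> C) <+> \<S>" for t
        using that p q is_weight_edge_perm[OF rep y(1)] C(2) is_weight_corner_perm[OF rep x(1)]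
        by (auto simp: \<xi>_def)
      show "\<exists>a b. same_kind a b \<and> \<xi> t a / \<xi> t b \<noteq> \<xi> t' a / \<xi> t' b"
        if t: "t \<in> (\<T> \<times> C) <+> \<S>" "t' \<in> (\<T> \<times> C) <+> \<S>" "t \<noteq> t'" for t t'
      proof -
        consider (ll) T c T' c' where "t = Inl (T, c)" "t' = Inl (T', c')" "T \<in> \<T>" "T' \<in> \<T>"
          | (lr) T c S where "t = Inl (T, c)" "t' = Inr S" "T \<in> \<T>" "S \<in> \<S>"
          | (rl) T c S where "t' = Inl (T, c)" "t = Inr S" "T \<in> \<T>" "S \<in> \<S>"
          | (rr) S S' where "t = Inr S" "t' = Inr S'" "S \<in> \<S>" "S' \<in> \<S>"
          using t(1,2) unfolding Plus_def by blast
        then show ?thesis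
        proof cases
          case ll
          have "\<exists>a<8. \<exists>b<8. cj c (x (p T a) / x (p T b)) \<noteq> cj c' (x (p T' a) / x (p T' b))"
          proof (cases "c = c'")
            case True
            then have "T \<noteq> T'" using ll t(3) by blast
            then show ?thesis using sep[OF ll(3,4)] unfolding True cj_simps(3) by blast
          next
            case False
            \<comment> \<open>Which of the two weights carries the conjugation is unknown, so
              separation is used in both orders.\<close>
            then show ?thesis
              using csep[OF ll(3,4)] csep[OF ll(4,3)] by (cases c; cases c') (auto simp: cj_def, metis)
          qed
          then show ?thesis unfolding ll xi(1) same_kind_def by blast
        next
          case lr
          then show ?thesis using left_right by blast
        next
          case rl
          then show ?thesis using left_right by metis
        next
          case rr
          then have "S \<noteq> S'" using t(3) by blast
          then obtain a b where "a \<in> {8..<20}" "b \<in> {8..<20}" "y (q S a) / y (q S b) \<noteq> y (q S' a) / y (q S' b)"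
            using sep'[OF rr(3,4)] by blast
          then show ?thesis using rr by (intro exI[of _ a] exI[of _ b]) (simp add: same_kind_def xi(2))
        qed
      qed
    qed
    moreover have "card ((\<T> \<times> C) <+> \<S>) = card \<T> * card C + card \<S>"
      using \<T> \<S> by (simp add: card_Plus card_cartesian_product)
    moreover have "8 * card C \<le> card \<T> * card C" using \<T>(2) by simp
    ultimately show ?thesis using \<S>(2) by linarith
  qed
qed

subsection \<open>Constructing representations\<close>

lemma invertible_matI:
  assumes "A \<in> carrier_mat n n" "B \<in> carrier_mat n n" "A * B = 1\<^sub>m n" "B * A = 1\<^sub>m n"
  shows "invertible_mat A"
  using assms unfolding invertible_mat_def inverts_mat_def by (intro conjI exI[of _ B]) auto

lemma is_repI:
  assumes car: "\<And>g. g \<in> G \<Longrightarrow> \<rho> g \<in> carrier_mat n n"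
    and hom: "\<And>g h. g \<in> G \<Longrightarrow> h \<in> G \<Longrightarrow> \<rho> (g \<circ> h) = \<rho> g * \<rho> h"
    and one: "\<rho> id = 1\<^sub>m n"
    and inv: "\<And>g. g \<in> G \<Longrightarrow> \<exists>h\<in>G. h \<circ> g = id \<and> g \<circ> h = id"
  shows "is_rep G n \<rho>"
proof -
  have "invertible_mat (\<rho> g)" if g: "g \<in> G" for g
  proof -
    obtain h where "h \<in> G" "h \<circ> g = id" "g \<circ> h = id" using inv[OF g] by blast
    then show ?thesis using car g hom[of g h] hom[of h g] one by (intro invertible_matI[of _ n "\<rho> h"]) auto
  qed
  then show ?thesis using car hom by (simp add: is_rep_def)
qed

lemma is_repD:
  assumes "is_rep G n \<rho>"
  shows "g \<in> G \<Longrightarrow> \<rho> g \<in> carrier_mat n n" "g \<in> G \<Longrightarrow> h \<in> G \<Longrightarrow> \<rho> (g \<circ> h) = \<rho> g * \<rho> h"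
  using assms by (auto simp: is_rep_def)

lemma dsum_mat_carrier: "A \<in> carrier_mat n n \<Longrightarrow> B \<in> carrier_mat m m \<Longrightarrow> dsum_mat A B \<in> carrier_mat (n + m) (n + m)"
  by (simp add: dsum_mat_def)

lemma dsum_mat_mult:
  assumes "A \<in> carrier_mat n n" "A' \<in> carrier_mat n n" "B \<in> carrier_mat m m" "B' \<in> carrier_mat m m"
  shows "dsum_mat A B * dsum_mat A' B' = dsum_mat (A * A') (B * (B' :: 'a::semiring_0 mat))"
  using assms unfolding dsum_mat_def
  by (subst mult_four_block_mat[of _ n n _ m _ m _ _ n _ m]) auto

lemma dsum_mat_index:
  assumes "A \<in> carrier_mat n n" "B \<in> carrier_mat m m" "i < n + m" "j < n + m"
  shows "dsum_mat A B $$ (i, j) = (if i < n then if j < n then A $$ (i, j) else 0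
     else if j < n then 0 else B $$ (i - n, j - n))"
  using assms by (auto simp: dsum_mat_def)

lemma dsum_mat_inject:
  assumes "A \<in> carrier_mat n n" "A' \<in> carrier_mat n n" "B \<in> carrier_mat m m" "B' \<in> carrier_mat m m"
    and eq: "dsum_mat A B = dsum_mat A' B'"
  shows "A = A'" "B = B'"
proof -
  show "A = A'"
  proof (rule eq_matI)
    fix i j assume ij: "i < dim_row A'" "j < dim_col A'"
    then show "A $$ (i, j) = A' $$ (i, j)"
      using arg_cong[OF eq, of "\<lambda>M. M $$ (i, j)"] assms(1-4) by (simp add: dsum_mat_def)
  qed (use assms in auto)
  show "B = B'"
  proof (rule eq_matI)
    fix i j assume ij: "i < dim_row B'" "j < dim_col B'"
    then show "B $$ (i, j) = B' $$ (i, j)"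
      using arg_cong[OF eq, of "\<lambda>M. M $$ (n + i, n + j)"] assms(1-4) by (simp add: dsum_mat_def)
  qed (use assms in auto)
qed

lemma is_rep_dsum:
  assumes \<rho>: "is_rep G n \<rho>" and \<sigma>: "is_rep G m \<sigma>"
    and grp: "id \<in> G" "\<And>g h. g \<in> G \<Longrightarrow> h \<in> G \<Longrightarrow> g \<circ> h \<in> G"
      "\<And>g. g \<in> G \<Longrightarrow> \<exists>h\<in>G. h \<circ> g = id \<and> g \<circ> h = id"
  shows "is_rep G (n + m) (\<lambda>g. dsum_mat (\<rho> g) (\<sigma> g))"
proof (rule is_repI)
  show "dsum_mat (\<rho> (g \<circ> h)) (\<sigma> (g \<circ> h)) = dsum_mat (\<rho> g) (\<sigma> g) * dsum_mat (\<rho> h) (\<sigma> h)"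
    if "g \<in> G" "h \<in> G" for g h
    using is_repD[OF \<rho>] is_repD[OF \<sigma>] that by (subst dsum_mat_mult[of _ n _ _ m]) auto
  show "dsum_mat (\<rho> id) (\<sigma> id) = 1\<^sub>m (n + m)"
    using rep_id[OF \<rho> grp(1)] rep_id[OF \<sigma> grp(1)] by (auto simp: dsum_mat_def)
qed (use is_repD[OF \<rho>] is_repD[OF \<sigma>] grp in \<open>auto intro: dsum_mat_carrier\<close>)

lemma map_mat_cnj_mult:
  assumes "A \<in> carrier_mat n m" "B \<in> carrier_mat m l"
  shows "map_mat cnj (A * B) = map_mat cnj A * map_mat cnj B"
  using assms by (intro eq_matI) (auto simp: scalar_prod_def)

lemma is_rep_conj:
  assumes \<rho>: "is_rep G n \<rho>" and grp: "id \<in> G" "\<And>g. g \<in> G \<Longrightarrow> \<exists>h\<in>G. h \<circ> g = id \<and> g \<circ> h = id"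
  shows "is_rep G n (conj_rep \<rho>)"
proof (rule is_repI)
  show "conj_rep \<rho> (g \<circ> h) = conj_rep \<rho> g * conj_rep \<rho> h" if "g \<in> G" "h \<in> G" for g h
    using is_repD[OF \<rho>] that map_mat_cnj_mult[of "\<rho> g" n n "\<rho> h" n] by (simp add: conj_rep_def)
  show "conj_rep \<rho> id = 1\<^sub>m n" using rep_id[OF \<rho> grp(1)] by (auto simp: conj_rep_def)
qed (use is_repD[OF \<rho>] grp in \<open>auto simp: conj_rep_def\<close>)

text \<open>A representation and its faithfulness transfer along the intertwiner, because real
  matrices embed injectively into complex ones. A real form thus needs only the intertwining
  equation and the right size.\<close>

lemma realizes_is_rep:
  assumes \<rho>: "is_rep G n \<rho>" and real: "realizes G n \<sigma> \<rho>" and car: "\<And>g. g \<in> G \<Longrightarrow> \<sigma> g \<in> carrier_mat n n"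
    and grp: "id \<in> G" "\<And>g h. g \<in> G \<Longrightarrow> h \<in> G \<Longrightarrow> g \<circ> h \<in> G"
      "\<And>g. g \<in> G \<Longrightarrow> \<exists>h\<in>G. h \<circ> g = id \<and> g \<circ> h = id"
  shows "is_rep G n \<sigma>" "inj_on \<rho> G \<Longrightarrow> inj_on \<sigma> G"
proof -
  obtain P where P: "P \<in> carrier_mat n n" "invertible_mat P"
    and eq: "\<And>g. g \<in> G \<Longrightarrow> P * \<rho> g = map_mat complex_of_real (\<sigma> g) * P"
    using real by (auto simp: realizes_def)
  obtain Q where Q: "Q \<in> carrier_mat n n" "P * Q = 1\<^sub>m n" "Q * P = 1\<^sub>m n" using invertible_matE[OF P(2,1)] .
  note car\<rho> = is_repD(1)[OF \<rho>]
  have conj: "map_mat complex_of_real (\<sigma> g) = P * \<rho> g * Q" if g: "g \<in> G" for g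
  proof -
    have "map_mat complex_of_real (\<sigma> g) = map_mat complex_of_real (\<sigma> g) * (P * Q)"
      using car[OF g] by (simp add: Q)
    also have "\<dots> = map_mat complex_of_real (\<sigma> g) * P * Q"
      by (rule assoc_mult_mat[symmetric]) (use car[OF g] P Q in auto)
    finally show ?thesis using eq[OF g] by simp
  qed
  have inj: "A = B" if "map_mat complex_of_real A = map_mat complex_of_real B" for A B
    using that by (rule of_real_hom.mat_hom_inj)
  show "is_rep G n \<sigma>"
  proof (rule is_repI)
    show "\<sigma> (g \<circ> h) = \<sigma> g * \<sigma> h" if gh: "g \<in> G" "h \<in> G" for g h
    proof (rule inj)
      let ?S = "\<lambda>g. map_mat complex_of_real (\<sigma> g)"
      have S: "?S g \<in> carrier_mat n n" "?S h \<in> carrier_mat n n" using car gh by auto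
      have "?S (g \<circ> h) = P * (\<rho> g * \<rho> h) * Q" using conj gh grp(2) is_repD(2)[OF \<rho> gh] by simp
      also have "P * (\<rho> g * \<rho> h) = P * \<rho> g * \<rho> h"
        by (rule assoc_mult_mat[symmetric]) (use P car\<rho> gh in auto)
      also have "\<dots> = ?S g * P * \<rho> h" using eq gh by simp
      also have "\<dots> = ?S g * (P * \<rho> h)" by (rule assoc_mult_mat) (use S P car\<rho> gh in auto)
      also have "\<dots> * Q = ?S g * (P * \<rho> h * Q)" by (rule assoc_mult_mat) (use S P Q car\<rho> gh in auto)
      also have "\<dots> = ?S g * ?S h" using conj gh by simp
      also have "\<dots> = map_mat complex_of_real (\<sigma> g * \<sigma> h)"
        by (rule of_real_hom.mat_hom_mult[symmetric]) (use car gh in auto)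
      finally show "?S (g \<circ> h) = map_mat complex_of_real (\<sigma> g * \<sigma> h)" .
    qed
    show "\<sigma> id = 1\<^sub>m n"
    proof (rule inj)
      show "map_mat complex_of_real (\<sigma> id) = map_mat complex_of_real (1\<^sub>m n)"
        using conj[OF grp(1)] rep_id[OF \<rho> grp(1)] P Q by (simp add: of_real_hom.mat_hom_one)
    qed
  qed (use car grp in auto)
  show "inj_on \<sigma> G" if "inj_on \<rho> G"
  proof (rule inj_onI)
    fix g h assume gh: "g \<in> G" "h \<in> G" "\<sigma> g = \<sigma> h"
    have recover: "\<rho> g = Q * (P * \<rho> g)" if "g \<in> G" for g
    proof -
      have "Q * (P * \<rho> g) = Q * P * \<rho> g" by (rule assoc_mult_mat[symmetric]) (use P Q car\<rho> that in auto)
      then show ?thesis using Q car\<rho>[OF that] by simp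
    qed
    have "P * \<rho> g = P * \<rho> h" using eq gh by simp
    then have "\<rho> g = \<rho> h" using recover gh by metis
    then show "g = h" using inj_onD[OF \<open>inj_on \<rho> G\<close>] gh by blast
  qed
qed

section \<open>The real form of a representation together with its conjugate\<close>

lemma sum_two_entries:
  fixes a b N :: nat
  assumes "a < N" "b < N"
  shows "(\<Sum>k<N. ((if k = a then x else 0) + (if k = b then y else 0)) * f k) = x * f a + y * (f b :: 'a::comm_semiring_1)"
proof -
  have delta: "(\<Sum>k<N. (if k = c then z else 0) * f k) = z * f c" if "c < N" for c z
  proof -
    have "(\<Sum>k<N. (if k = c then z else 0) * f k) = (\<Sum>k<N. if k = c then z * f k else 0)"
      by (rule sum.cong) auto
    then show ?thesis using that by simp
  qed
  show ?thesis using assms by (simp only: distrib_right sum.distrib delta)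
qed

lemma two_entry_row_mult:
  assumes "P \<in> carrier_mat N N" "M \<in> carrier_mat N N" "i < N" "j < N" "a < N" "b < N"
    and "\<And>k. k < N \<Longrightarrow> P $$ (i, k) = (if k = a then x else 0) + (if k = b then y else 0)"
  shows "(P * M) $$ (i, j) = x * M $$ (a, j) + y * (M $$ (b, j) :: 'a::comm_semiring_1)"
proof -
  have "(P * M) $$ (i, j) = (\<Sum>k<N. P $$ (i, k) * M $$ (k, j))"
    using assms by (auto simp: scalar_prod_def atLeast0LessThan intro!: sum.cong)
  also have "\<dots> = (\<Sum>k<N. ((if k = a then x else 0) + (if k = b then y else 0)) * M $$ (k, j))"
    using assms(7) by (intro sum.cong refl) simp
  finally show ?thesis using sum_two_entries[OF assms(5,6)] by simp
qed

lemma two_entry_col_mult: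
  assumes "P \<in> carrier_mat N N" "M \<in> carrier_mat N N" "i < N" "j < N" "a < N" "b < N"
    and "\<And>k. k < N \<Longrightarrow> P $$ (k, j) = (if k = a then x else 0) + (if k = b then y else 0)"
  shows "(M * P) $$ (i, j) = x * M $$ (i, a) + y * (M $$ (i, b) :: 'a::comm_semiring_1)"
proof -
  have "(M * P) $$ (i, j) = (\<Sum>k<N. P $$ (k, j) * M $$ (i, k))"
    using assms by (auto simp: scalar_prod_def atLeast0LessThan mult.commute intro!: sum.cong)
  also have "\<dots> = (\<Sum>k<N. ((if k = a then x else 0) + (if k = b then y else 0)) * M $$ (i, k))"
    using assms(7) by (intro sum.cong refl) simp
  finally show ?thesis using sum_two_entries[OF assms(5,6)] by simp
qed

text \<open>The change of basis \<open>(u, v, w) \<mapsto> (u, v + w, - i (v - w))\<close> turns \<open>V \<oplus> cnj V\<close> into its realification.\<close>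
lemma realizes_with_conjugate:
  fixes \<sigma>r :: "('g \<Rightarrow> 'g) \<Rightarrow> real mat" and \<rho> :: "('g \<Rightarrow> 'g) \<Rightarrow> complex mat"
  assumes r: "\<And>g. g \<in> G \<Longrightarrow> \<sigma>r g \<in> carrier_mat n n" and \<rho>: "\<And>g. g \<in> G \<Longrightarrow> \<rho> g \<in> carrier_mat m m"
  defines "N \<equiv> n + m + m"
  shows "\<exists>\<sigma>. (\<forall>g. \<sigma> g \<in> carrier_mat N N) \<and>
    realizes G N \<sigma> (\<lambda>g. dsum_mat (dsum_mat (map_mat complex_of_real (\<sigma>r g)) (\<rho> g)) (conj_rep \<rho> g))"
proof -
  \<comment> \<open>After the block \<open>\<sigma>r\<close>, this is the usual real block matrix of
    a complex one: \<open>Re\<close> on the diagonal, \<open>-Im\<close> above and \<open>Im\<close>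
    below.\<close>
  define \<sigma> where "\<sigma> g = mat N N (\<lambda>(i, j).
     if i < n then if j < n then \<sigma>r g $$ (i, j) else 0
     else if i < n + m then
       if j < n then 0 else if j < n + m then Re (\<rho> g $$ (i - n, j - n)) else - Im (\<rho> g $$ (i - n, j - n - m))
     else if j < n then 0 else if j < n + m then Im (\<rho> g $$ (i - n - m, j - n))
       else Re (\<rho> g $$ (i - n - m, j - n - m)))" for g
  define P where "P = mat N N (\<lambda>(i, j).
     if i < n then if j = i then 1 else 0
     else if i < n + m then (if j = i then 1 else 0) + (if j = i + m then 1 else 0)
     else (if j = i - m then - \<i> else 0) + (if j = i then \<i> else 0))"
  \<comment> \<open>\<open>Q\<close> solves \<open>s = v + w\<close>, \<open>t = - i (v - w)\<close>
    for \<open>v = (s + i t) / 2\<close> and \<open>w = (s - i t) / 2\<close>.\<close>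
  define Q where "Q = mat N N (\<lambda>(i, j).
     if i < n then if j = i then 1 else 0
     else if i < n + m then (if j = i then 1 / 2 else 0) + (if j = i + m then \<i> / 2 else 0)
     else (if j = i - m then 1 / 2 else 0) + (if j = i then - \<i> / 2 else 0))"
  have P: "P \<in> carrier_mat N N" and Q: "Q \<in> carrier_mat N N" by (auto simp: P_def Q_def)
  have left: "(P * M) $$ (i, j) = (if i < n then M $$ (i, j)
      else if i < n + m then M $$ (i, j) + M $$ (i + m, j) else - \<i> * M $$ (i - m, j) + \<i> * M $$ (i, j))"
    if M: "M \<in> carrier_mat N N" and ij: "i < N" "j < N" for M i j
  proof -
    consider "i < n" | "\<not> i < n" "i < n + m" | "\<not> i < n + m" by linarith
    then show ?thesis
    proof cases
      case 1
      \<comment> \<open>A row with one entry is read as a two-entry row whose second coefficient is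
        0.\<close>
      then have "(P * M) $$ (i, j) = 1 * M $$ (i, j) + 0 * M $$ (i, j)"
        by (intro two_entry_row_mult[OF P M ij ij(1) ij(1)]) (use ij in \<open>auto simp: P_def\<close>)
      then show ?thesis using 1 by simp
    next
      case 2
      then have "(P * M) $$ (i, j) = 1 * M $$ (i, j) + 1 * M $$ (i + m, j)"
        by (intro two_entry_row_mult[OF P M ij ij(1)]) (use ij in \<open>auto simp: P_def N_def\<close>)
      then show ?thesis using 2 by simp
    next
      case 3
      then have "(P * M) $$ (i, j) = - \<i> * M $$ (i - m, j) + \<i> * M $$ (i, j)"
        by (intro two_entry_row_mult[OF P M ij _ ij(1)]) (use ij in \<open>auto simp: P_def N_def\<close>)
      then show ?thesis using 3 by simp
    qed
  qed
  have right: "(M * P) $$ (i, j) = (if j < n then M $$ (i, j)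
      else if j < n + m then M $$ (i, j) - \<i> * M $$ (i, j + m) else M $$ (i, j - m) + \<i> * M $$ (i, j))"
    if M: "M \<in> carrier_mat N N" and ij: "i < N" "j < N" for M i j
  proof -
    consider "j < n" | "\<not> j < n" "j < n + m" | "\<not> j < n + m" by linarith
    then show ?thesis
    proof cases
      case 1
      then have "(M * P) $$ (i, j) = 1 * M $$ (i, j) + 0 * M $$ (i, j)"
        by (intro two_entry_col_mult[OF P M ij ij(2) ij(2)]) (use ij in \<open>auto simp: P_def\<close>)
      then show ?thesis using 1 by simp
    next
      case 2
      then have "(M * P) $$ (i, j) = 1 * M $$ (i, j) + (- \<i>) * M $$ (i, j + m)"
        by (intro two_entry_col_mult[OF P M ij ij(2)]) (use ij in \<open>auto simp: P_def N_def\<close>)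
      then show ?thesis using 2 by simp
    next
      case 3
      then have "(M * P) $$ (i, j) = 1 * M $$ (i, j - m) + \<i> * M $$ (i, j)"
        by (intro two_entry_col_mult[OF P M ij _ ij(2)]) (use ij in \<open>auto simp: P_def N_def\<close>)
      then show ?thesis using 3 by simp
    qed
  qed
  have "P * Q = 1\<^sub>m N"
  proof (rule eq_matI)
    fix i j assume "i < dim_row (1\<^sub>m N :: complex mat)" "j < dim_col (1\<^sub>m N :: complex mat)"
    then have ij: "i < N" "j < N" by auto
    then show "(P * Q) $$ (i, j) = 1\<^sub>m N $$ (i, j)"
      unfolding left[OF Q ij] by (auto simp: Q_def N_def field_simps)
  qed (use P Q in auto)
  then have inv: "invertible_mat P"
    using invertible_matI[OF P Q] mat_mult_left_right_inverse[OF P Q] by blast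
  have "P * dsum_mat (dsum_mat (map_mat complex_of_real (\<sigma>r g)) (\<rho> g)) (conj_rep \<rho> g)
      = map_mat complex_of_real (\<sigma> g) * P" (is "P * ?M = ?S * P") if g: "g \<in> G" for g
  proof (rule eq_matI)
    have car: "map_mat complex_of_real (\<sigma>r g) \<in> carrier_mat n n" "\<rho> g \<in> carrier_mat m m"
      "conj_rep \<rho> g \<in> carrier_mat m m" using r \<rho> g by (auto simp: conj_rep_def)
    have M: "?M \<in> carrier_mat N N" unfolding N_def by (intro dsum_mat_carrier car)
    have S: "?S \<in> carrier_mat N N" by (simp add: \<sigma>_def)
    show "dim_row (P * ?M) = dim_row (?S * P)" "dim_col (P * ?M) = dim_col (?S * P)" using P M S by auto
    fix i j assume "i < dim_row (?S * P)" "j < dim_col (?S * P)"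
    then have ij: "i < N" "j < N" using P S by auto
    have Mij: "?M $$ (i, j) = (if i < n + m then if j < n + m then
        (if i < n then if j < n then complex_of_real (\<sigma>r g $$ (i, j)) else 0
         else if j < n then 0 else \<rho> g $$ (i - n, j - n)) else 0
      else if j < n + m then 0 else cnj (\<rho> g $$ (i - n - m, j - n - m)))" if "i < N" "j < N" for i j
      using that car r[OF g] dsum_mat_index[OF dsum_mat_carrier[OF car(1,2)] car(3), of i j]
        dsum_mat_index[OF car(1,2), of i j] by (auto simp: N_def conj_rep_def diff_diff_left)
    have Sij: "?S $$ (i, j) = complex_of_real (if i < n then if j < n then \<sigma>r g $$ (i, j) else 0
     else if i < n + m then
       if j < n then 0 else if j < n + m then Re (\<rho> g $$ (i - n, j - n)) else - Im (\<rho> g $$ (i - n, j - n - m))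
     else if j < n then 0 else if j < n + m then Im (\<rho> g $$ (i - n - m, j - n))
       else Re (\<rho> g $$ (i - n - m, j - n - m)))" if "i < N" "j < N" for i j
      using that by (simp add: \<sigma>_def)
    show "(P * ?M) $$ (i, j) = (?S * P) $$ (i, j)"
      unfolding left[OF M ij] right[OF S ij] using ij
      by (cases "i < n"; cases "i < n + m"; cases "j < n"; cases "j < n + m")
        (simp_all add: Mij Sij N_def complex_eq_iff diff_diff_left add.commute, arith+)
  qed
  then have "realizes G N \<sigma> (\<lambda>g. dsum_mat (dsum_mat (map_mat complex_of_real (\<sigma>r g)) (\<rho> g)) (conj_rep \<rho> g))"
    unfolding realizes_def using P inv by blast
  then show ?thesis by (intro exI[of _ \<sigma>]) (auto simp: \<sigma>_def)
qed

section \<open>Monomial representations on corners and on edges\<close>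

lemma twist_less: "cubie z < 8 \<Longrightarrow> twist z < 3" "8 \<le> cubie z \<Longrightarrow> twist z < 2"
proof -
  have "\<forall>z\<in>{1..48}. (cubie z < 8 \<longrightarrow> twist z < 3) \<and> (8 \<le> cubie z \<longrightarrow> twist z < 2)"
    by (simp only: all_stickers sticker_eval) simp
  moreover have "twist z = 0" if "z \<notin> {1..48}"
  proof -
    have "filter (\<lambda>c. z \<in> set c) cubies = []" using that by (auto simp: cubies_def)
    then show ?thesis by (simp add: twist_def)
  qed
  ultimately show "cubie z < 8 \<Longrightarrow> twist z < 3" "8 \<le> cubie z \<Longrightarrow> twist z < 2"
    by (cases "z \<in> {1..48}"; force)+
qed

lemma twist_spin:
  "cubie z < 8 \<Longrightarrow> twist (spin z) = (twist z + 1) mod 3"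
  "8 \<le> cubie z \<Longrightarrow> cubie z < 20 \<Longrightarrow> twist (spin z) = (twist z + 1) mod 2"
proof -
  have *: "\<forall>z\<in>{1..48}. (cubie z < 8 \<longrightarrow> twist (spin z) = (twist z + 1) mod 3) \<and>
      (8 \<le> cubie z \<longrightarrow> twist (spin z) = (twist z + 1) mod 2)"
    by (simp only: all_stickers sticker_eval) simp
  show "cubie z < 8 \<Longrightarrow> twist (spin z) = (twist z + 1) mod 3"
    using * cubie_less[of z] by force
  show "8 \<le> cubie z \<Longrightarrow> cubie z < 20 \<Longrightarrow> twist (spin z) = (twist z + 1) mod 2"
    using * cubie_less[of z] by blast
qed

text \<open>Corners and edges are treated alike: a block of cubies preserved by \<open>G3\<close>,
  and a root of unity whose powers follow \<open>spin\<close> and still distinguish the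
  twists.\<close>

locale cubie_block =
  fixes a m :: nat and \<zeta> :: "'a::field"
  assumes block_bound: "a + m \<le> 20"
    and block_G3: "g \<in> G3 \<Longrightarrow> cubie z \<in> {a..<a + m} \<Longrightarrow> cubie (g z) \<in> {a..<a + m}"
    and root_twist_spin: "cubie z \<in> {a..<a + m} \<Longrightarrow> \<zeta> ^ twist (spin z) = \<zeta> * \<zeta> ^ twist z"
    and root_twist_inj: "cubie z \<in> {a..<a + m} \<Longrightarrow> cubie z' \<in> {a..<a + m} \<Longrightarrow> \<zeta> ^ twist z = \<zeta> ^ twist z' \<Longrightarrow> twist z = twist z'"
    and root_nonzero: "\<zeta> \<noteq> 0"
begin

text \<open>Column \<open>j\<close> records the image of one home sticker: its cubie selects the row
  and its twist the root of unity.\<close>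

definition monomial_rep :: "(nat \<Rightarrow> nat) \<Rightarrow> 'a mat" where
  "monomial_rep g = mat m m (\<lambda>(i, j). if cubie (g (home (a + j))) = a + i then \<zeta> ^ twist (g (home (a + j))) else 0)"

lemma root_twist_funpow: "cubie z \<in> {a..<a + m} \<Longrightarrow> \<zeta> ^ twist ((spin ^^ s) z) = \<zeta> ^ s * \<zeta> ^ twist z"
  by (induction s) (simp_all add: root_twist_spin)

lemma home_block: "j < m \<Longrightarrow> cubie (home (a + j)) = a + j" "j < m \<Longrightarrow> twist (home (a + j)) = 0"
  using home_props(2,3)[of "a + j"] block_bound by simp_all

text \<open>\<open>h\<close> takes a home sticker to a power of \<open>spin\<close> applied to
  another home sticker, and \<open>g\<close> commutes with that power; twists add and the roots of
  unity multiply.\<close>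

lemma monomial_rep_mult:
  assumes g: "g \<in> G3" and h: "h \<in> G3"
  shows "monomial_rep (g \<circ> h) = monomial_rep g * monomial_rep h"
proof (rule eq_matI)
  fix i j assume "i < dim_row (monomial_rep g * monomial_rep h)" "j < dim_col (monomial_rep g * monomial_rep h)"
  then have ij: "i < m" "j < m" by (auto simp: monomial_rep_def)
  define z where "z = h (home (a + j))"
  have z: "cubie z \<in> {a..<a + m}" using block_G3[OF h, of "home (a + j)"] home_block[OF ij(2)] ij by (simp add: z_def)
  define k where "k = cubie z - a"
  have k: "k < m" "cubie z = a + k" using z by (auto simp: k_def)
  define w where "w = g (home (a + k))"
  have w: "cubie w \<in> {a..<a + m}" using block_G3[OF g, of "home (a + k)"] home_block[OF k(1)] k by (simp add: w_def)
  have "z = (spin ^^ twist z) (home (a + k))" using sticker_home[of z] z k block_bound by simp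
  then have gz: "g z = (spin ^^ twist z) w" using G3_funpow_spin[OF g] w_def by metis
  have "(monomial_rep g * monomial_rep h) $$ (i, j) = (\<Sum>l<m. monomial_rep g $$ (i, l) * monomial_rep h $$ (l, j))"
    using ij by (auto simp: monomial_rep_def scalar_prod_def atLeast0LessThan intro!: sum.cong)
  also have "\<dots> = (\<Sum>l<m. if l = k then monomial_rep g $$ (i, k) * \<zeta> ^ twist z else 0)"
    using ij k by (intro sum.cong) (auto simp: monomial_rep_def z_def[symmetric])
  also have "\<dots> = monomial_rep g $$ (i, k) * \<zeta> ^ twist z" using k by simp
  also have "\<dots> = (if cubie (g z) = a + i then \<zeta> ^ twist (g z) else 0)"
    using ij k w by (simp add: monomial_rep_def w_def[symmetric] gz root_twist_funpow mult.commute)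
  also have "\<dots> = monomial_rep (g \<circ> h) $$ (i, j)" using ij by (simp add: monomial_rep_def z_def)
  finally show "monomial_rep (g \<circ> h) $$ (i, j) = (monomial_rep g * monomial_rep h) $$ (i, j)" by simp
qed (auto simp: monomial_rep_def)

lemma is_rep_monomial: "is_rep G3 m monomial_rep"
proof (rule is_repI)
  show "monomial_rep id = 1\<^sub>m m"
    by (rule eq_matI) (auto simp: monomial_rep_def home_block)
qed (use monomial_rep_mult G3_inverse in \<open>auto simp: monomial_rep_def\<close>)

text \<open>The nonzero entry of a column reveals the cubie and, by injectivity of the powers, the
  twist of the image of the home sticker. The other stickers of the cubie follow by
  \<open>spin\<close>.\<close>

lemma monomial_rep_determines:
  assumes g: "g \<in> G3" and h: "h \<in> G3" and eq: "monomial_rep g = monomial_rep h" and z: "cubie z \<in> {a..<a + m}"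
  shows "g z = h z"
proof -
  define c where "c = home (cubie z)"
  obtain j where j: "j < m" "cubie z = a + j" using z by (metis atLeastLessThan_iff le_Suc_ex nat_add_left_cancel_less)
  have cc: "c = home (a + j)" using j by (simp add: c_def)
  have blk: "cubie (g c) \<in> {a..<a + m}" "cubie (h c) \<in> {a..<a + m}"
    using block_G3[OF g, of c] block_G3[OF h, of c] home_block[OF j(1)] j by (simp_all add: cc)
  obtain i where i: "i < m" "cubie (g c) = a + i" using blk(1) by (metis atLeastLessThan_iff le_Suc_ex nat_add_left_cancel_less)
  have "(if cubie (h c) = a + i then \<zeta> ^ twist (h c) else 0) = \<zeta> ^ twist (g c)"
    using arg_cong[OF eq, of "\<lambda>M. M $$ (i, j)"] i j by (simp add: monomial_rep_def cc[symmetric])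
  then have "cubie (h c) = cubie (g c)" "\<zeta> ^ twist (h c) = \<zeta> ^ twist (g c)"
    using i root_nonzero by (auto split: if_splits)
  then have "cubie (h c) = cubie (g c)" "twist (h c) = twist (g c)" using root_twist_inj blk by auto
  then have "g c = h c" using sticker_home[of "g c"] sticker_home[of "h c"] blk block_bound by auto
  moreover have "z = (spin ^^ twist z) c" using sticker_home[of z] z block_bound by (simp add: c_def)
  ultimately show ?thesis using G3_funpow_spin[OF g] G3_funpow_spin[OF h] by metis
qed

end

lemma edge_block: "cubie_block 8 12 (-1 :: 'a::field_char_0)"
proof
  show "cubie (g z) \<in> {8..<8 + 12}" if "g \<in> G3" "cubie z \<in> {8..<8 + 12}" for g z
    using G3_corner[OF that(1), of z] G3_cubie_less[OF that(1), of z] that(2) by auto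
  show "(- 1 :: 'a) ^ twist (spin z) = - 1 * (- 1) ^ twist z" if "cubie z \<in> {8..<8 + 12}" for z
  proof -
    have "twist z = 0 \<or> twist z = 1" using twist_less(2)[of z] that by auto
    then show ?thesis using twist_spin(2)[of z] that by auto
  qed
  show "twist z = twist z'"
    if "cubie z \<in> {8..<8 + 12}" "cubie z' \<in> {8..<8 + 12}" "(- 1 :: 'a) ^ twist z = (- 1) ^ twist z'" for z z'
  proof -
    have "twist z = 0 \<or> twist z = 1" "twist z' = 0 \<or> twist z' = 1"
      using twist_less(2)[of z] twist_less(2)[of z'] that by auto
    then show ?thesis using that(3) by auto
  qed
qed auto

lemma corner_block: "cubie_block 0 8 (cis (2 * pi / 3))"
proof -
  define \<omega> where "\<omega> = cis (2 * pi / 3)"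
  have sq: "\<omega> * \<omega> = Complex (- 1 / 2) (- sqrt 3 / 2)"
    by (simp add: \<omega>_def omega_eq complex_eq_iff)
  have cube: "\<omega> * (\<omega> * \<omega>) = 1" unfolding sq by (simp add: \<omega>_def omega_eq complex_eq_iff)
  have dist: "\<omega> \<noteq> 1" "\<omega> * \<omega> \<noteq> 1" "\<omega> * \<omega> \<noteq> \<omega>" unfolding sq by (simp_all add: \<omega>_def omega_eq complex_eq_iff)
  have "cubie_block 0 8 \<omega>"
  proof
    show "cubie (g z) \<in> {0..<0 + 8}" if "g \<in> G3" "cubie z \<in> {0..<0 + 8}" for g z
      using G3_corner[OF that(1), of z] that(2) by auto
    show "\<omega> ^ twist (spin z) = \<omega> * \<omega> ^ twist z" if "cubie z \<in> {0..<0 + 8}" for z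
    proof -
      have "twist z = 0 \<or> twist z = 1 \<or> twist z = 2" using twist_less(1)[of z] that by auto
      then show ?thesis using twist_spin(1)[of z] that cube by (auto simp: power2_eq_square)
    qed
    show "twist z = twist z'"
      if "cubie z \<in> {0..<0 + 8}" "cubie z' \<in> {0..<0 + 8}" "\<omega> ^ twist z = \<omega> ^ twist z'" for z z'
    proof -
      have "twist z = 0 \<or> twist z = 1 \<or> twist z = 2" "twist z' = 0 \<or> twist z' = 1 \<or> twist z' = 2"
        using twist_less(1)[of z] twist_less(1)[of z'] that by auto
      then show ?thesis using that(3) dist by (auto simp: power2_eq_square)
    qed
    show "\<omega> \<noteq> 0" by (simp add: \<omega>_def)
  qed auto
  then show ?thesis by (simp add: \<omega>_def)
qed

section \<open>Passing between real and complex representations, and the final dimensions\<close>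

lemma is_rep_of_real:
  assumes "is_rep G n \<sigma>" "id \<in> G" "\<And>g. g \<in> G \<Longrightarrow> \<exists>h\<in>G. h \<circ> g = id \<and> g \<circ> h = id"
  shows "is_rep G n (\<lambda>g. map_mat complex_of_real (\<sigma> g))"
proof (rule is_repI)
  show "map_mat complex_of_real (\<sigma> (g \<circ> h)) = map_mat complex_of_real (\<sigma> g) * map_mat complex_of_real (\<sigma> h)"
    if "g \<in> G" "h \<in> G" for g h
    using is_repD[OF assms(1)] that of_real_hom.mat_hom_mult[of "\<sigma> g" n n "\<sigma> h" n] by simp
  show "map_mat complex_of_real (\<sigma> id) = 1\<^sub>m n" using rep_id[OF assms(1,2)] by (simp add: of_real_hom.mat_hom_one)
qed (use is_repD[OF assms(1)] assms in auto)

lemma faithful_rep_of_real: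
  assumes "faithful_rep G3 n \<sigma>"
  shows "faithful_rep G3 n (\<lambda>g. map_mat complex_of_real (\<sigma> g))"
  using assms is_rep_of_real[of G3 n \<sigma>] G3_id G3_inverse of_real_hom.mat_hom_inj
  unfolding faithful_rep_def inj_on_def by blast

lemma complex_dimension_lower_bound: "faithful_rep G3 n \<rho> \<Longrightarrow> 20 \<le> n" for \<rho> :: "(nat \<Rightarrow> nat) \<Rightarrow> complex mat"
  using dimension_lower_bound[of n \<rho> "{False}"] by (simp add: cj_def comp_def)

text \<open>For real matrices the conjugate of a joint eigenvector is a joint eigenvector for the
  conjugate weight, so both booleans are admissible.\<close>

lemma real_dimension_lower_bound:
  fixes \<sigma> :: "(nat \<Rightarrow> nat) \<Rightarrow> real mat"
  assumes \<sigma>: "faithful_rep G3 n \<sigma>" shows "28 \<le> n"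
proof -
  define \<rho> where "\<rho> g = map_mat complex_of_real (\<sigma> g)" for g
  have f: "faithful_rep G3 n \<rho>" using faithful_rep_of_real[OF \<sigma>] by (simp add: \<rho>_def[abs_def])
  have conj: "is_weight \<rho> n (cj c \<circ> x)" if x: "is_weight \<rho> n x" for c x
  proof (cases c)
    case True
    obtain v where v: "v \<in> carrier_vec n" "v \<noteq> 0\<^sub>v n"
      and eig: "\<And>i j. same_kind i j \<Longrightarrow> \<rho> (twist_pair i j) *\<^sub>v v = (x i / x j) \<cdot>\<^sub>v v"
      using x by (auto simp: is_weight_def)
    define u where "u = map_vec cnj v"
    have u: "u \<in> carrier_vec n" using v by (simp add: u_def)
    have "u \<noteq> 0\<^sub>v n"
    proof
      assume u0: "u = 0\<^sub>v n"
      have "v = 0\<^sub>v n"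
      proof (rule eq_vecI)
        fix k assume "k < dim_vec (0\<^sub>v n :: complex vec)"
        then show "v $ k = 0\<^sub>v n $ k" using arg_cong[OF u0, of "\<lambda>w. w $ k"] v(1) by (simp add: u_def)
      qed (use v in auto)
      then show False using v(2) by simp
    qed
    moreover have "\<rho> (twist_pair i j) *\<^sub>v u = ((cj c \<circ> x) i / (cj c \<circ> x) j) \<cdot>\<^sub>v u" if ij: "same_kind i j" for i j
    proof (rule eq_vecI)
      have S: "\<sigma> (twist_pair i j) \<in> carrier_mat n n"
        using \<sigma> twist_pair_G3[OF ij] by (simp add: faithful_rep_def is_rep_def)
      show "dim_vec (\<rho> (twist_pair i j) *\<^sub>v u) = dim_vec (((cj c \<circ> x) i / (cj c \<circ> x) j) \<cdot>\<^sub>v u)"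
        using S u by (simp add: \<rho>_def)
      fix k assume "k < dim_vec (((cj c \<circ> x) i / (cj c \<circ> x) j) \<cdot>\<^sub>v u)"
      then have k: "k < n" using u by simp
      have "(\<rho> (twist_pair i j) *\<^sub>v u) $ k = cnj ((\<rho> (twist_pair i j) *\<^sub>v v) $ k)"
        using k S v(1) by (simp add: \<rho>_def u_def scalar_prod_def)
      then show "(\<rho> (twist_pair i j) *\<^sub>v u) $ k = (((cj c \<circ> x) i / (cj c \<circ> x) j) \<cdot>\<^sub>v u) $ k"
        using k v(1) True unfolding eig[OF ij] by (simp add: u_def cj_def)
    qed
    ultimately show ?thesis
      using x u True unfolding is_weight_def by (auto simp: cj_def simp flip: complex_cnj_power)
  qed (use x in \<open>simp add: cj_def comp_def\<close>)
  show ?thesis using dimension_lower_bound[OF f, of UNIV] conj by simp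
qed

theorem theorem5p2:
  shows "mdim TYPE(complex) G3 = 20 \<and> mdim TYPE(real) G3 = 28 \<and>
    (\<exists>(\<rho>r :: (nat \<Rightarrow> nat) \<Rightarrow> complex mat) (\<rho>n :: (nat \<Rightarrow> nat) \<Rightarrow> complex mat).
       is_rep G3 12 \<rho>r \<and> is_rep G3 8 \<rho>n \<and>
       faithful_rep G3 20 (\<lambda>g. dsum_mat (\<rho>r g) (\<rho>n g)) \<and>
       realizable_over_R G3 12 \<rho>r \<and>
       (\<exists>\<sigma> :: (nat \<Rightarrow> nat) \<Rightarrow> real mat.
          faithful_rep G3 28 \<sigma> \<and>
          realizes G3 28 \<sigma> (\<lambda>g. dsum_mat (dsum_mat (\<rho>r g) (\<rho>n g)) (conj_rep \<rho>n g))))"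
proof -
  \<comment> \<open>The edge block is built over the reals and then complexified, so its real form
    comes with it.\<close>
  interpret edge: cubie_block 8 12 "-1 :: real" by (rule edge_block)
  interpret corner: cubie_block 0 8 "cis (2 * pi / 3)" by (rule corner_block)
  define \<sigma>r where "\<sigma>r = edge.monomial_rep"
  define \<rho>r where "\<rho>r g = map_mat complex_of_real (\<sigma>r g)" for g
  define \<rho>n where "\<rho>n = corner.monomial_rep"
  note grp = G3_id G3_comp G3_inverse
  have \<sigma>r: "is_rep G3 12 \<sigma>r" unfolding \<sigma>r_def by (rule edge.is_rep_monomial)
  have \<rho>r: "is_rep G3 12 \<rho>r" unfolding \<rho>r_def[abs_def] by (rule is_rep_of_real[OF \<sigma>r G3_id G3_inverse])
  have \<rho>n: "is_rep G3 8 \<rho>n" unfolding \<rho>n_def by (rule corner.is_rep_monomial)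
  have V: "is_rep G3 20 (\<lambda>g. dsum_mat (\<rho>r g) (\<rho>n g))" using is_rep_dsum[OF \<rho>r \<rho>n grp] by simp
  have determined: "g = h" if gh: "g \<in> G3" "h \<in> G3" "dsum_mat (\<rho>r g) (\<rho>n g) = dsum_mat (\<rho>r h) (\<rho>n h)" for g h
  proof
    fix z
    have "\<rho>r g = \<rho>r h" and n: "\<rho>n g = \<rho>n h"
      using dsum_mat_inject[OF is_repD(1)[OF \<rho>r gh(1)] is_repD(1)[OF \<rho>r gh(2)]
          is_repD(1)[OF \<rho>n gh(1)] is_repD(1)[OF \<rho>n gh(2)] gh(3)] by auto
    then have r: "\<sigma>r g = \<sigma>r h" unfolding \<rho>r_def by (intro of_real_hom.mat_hom_inj)
    consider "cubie z < 8" | "8 \<le> cubie z" "cubie z < 20" | "z \<notin> {1..48}" using cubie_less[of z] by linarith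
    then show "g z = h z"
    proof cases
      case 1
      then show ?thesis using corner.monomial_rep_determines[OF gh(1,2), of z] n by (simp add: \<rho>n_def)
    next
      case 2
      then show ?thesis using edge.monomial_rep_determines[OF gh(1,2), of z] r by (simp add: \<sigma>r_def)
    next
      case 3
      then show ?thesis using G3_outside[OF gh(1) 3] G3_outside[OF gh(2) 3] by simp
    qed
  qed
  then have V_inj: "inj_on (\<lambda>g. dsum_mat (\<rho>r g) (\<rho>n g)) G3" by (simp add: inj_on_def)
  have V_faithful: "faithful_rep G3 20 (\<lambda>g. dsum_mat (\<rho>r g) (\<rho>n g))" using V V_inj by (simp add: faithful_rep_def)
  have conj: "is_rep G3 8 (conj_rep \<rho>n)" by (rule is_rep_conj[OF \<rho>n G3_id G3_inverse])
  have W: "is_rep G3 28 (\<lambda>g. dsum_mat (dsum_mat (\<rho>r g) (\<rho>n g)) (conj_rep \<rho>n g))"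
    using is_rep_dsum[OF V conj grp] by simp
  have W_inj: "inj_on (\<lambda>g. dsum_mat (dsum_mat (\<rho>r g) (\<rho>n g)) (conj_rep \<rho>n g)) G3"
  proof (rule inj_onI)
    fix g h assume gh: "g \<in> G3" "h \<in> G3"
      "dsum_mat (dsum_mat (\<rho>r g) (\<rho>n g)) (conj_rep \<rho>n g) = dsum_mat (dsum_mat (\<rho>r h) (\<rho>n h)) (conj_rep \<rho>n h)"
    note C = is_repD(1)[OF conj]
    show "g = h"
      using dsum_mat_inject(1)[OF is_repD(1)[OF V gh(1)] is_repD(1)[OF V gh(2)] C[OF gh(1)] C[OF gh(2)] gh(3)]
      by (rule determined[OF gh(1,2)])
  qed
  have "\<exists>\<sigma>. (\<forall>g. \<sigma> g \<in> carrier_mat 28 28) \<and>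
      realizes G3 28 \<sigma> (\<lambda>g. dsum_mat (dsum_mat (\<rho>r g) (\<rho>n g)) (conj_rep \<rho>n g))"
    using realizes_with_conjugate[of G3 \<sigma>r 12 \<rho>n 8] is_repD(1)[OF \<sigma>r] is_repD(1)[OF \<rho>n]
    by (simp add: \<rho>r_def)
  then obtain \<sigma> where car: "\<And>g. \<sigma> g \<in> carrier_mat 28 28"
    and real: "realizes G3 28 \<sigma> (\<lambda>g. dsum_mat (dsum_mat (\<rho>r g) (\<rho>n g)) (conj_rep \<rho>n g))"
    by blast
  have \<sigma>: "faithful_rep G3 28 \<sigma>"
    using realizes_is_rep[OF W real car grp] W_inj by (simp add: faithful_rep_def)
  have "realizes G3 12 \<sigma>r \<rho>r"
    unfolding realizes_def
  proof (intro exI[of _ "1\<^sub>m 12"] conjI ballI)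
    show "invertible_mat (1\<^sub>m 12 :: complex mat)" by (rule invertible_matI[of _ 12 "1\<^sub>m 12"]) auto
    show "1\<^sub>m 12 * \<rho>r g = map_mat complex_of_real (\<sigma>r g) * 1\<^sub>m 12" if "g \<in> G3" for g
      using is_repD(1)[OF \<rho>r that] by (simp add: \<rho>r_def)
  qed simp
  then have realizable: "realizable_over_R G3 12 \<rho>r" using \<sigma>r by (auto simp: realizable_over_R_def)
  have "mdim TYPE(complex) G3 = 20" unfolding mdim_def
    by (rule Least_equality) (use V_faithful complex_dimension_lower_bound in blast)+
  moreover have "mdim TYPE(real) G3 = 28" unfolding mdim_def
    by (rule Least_equality) (use \<sigma> real_dimension_lower_bound in blast)+
  ultimately show ?thesis using \<rho>r \<rho>n V_faithful realizable \<sigma> real by blast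
qed

end
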